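(* Suppose $H$ is a Hilbert space, $\mathcal{A}$ is an irreducible $C^*$-subalgebra of $B(H)$, $x \in B(H)$, the operator $M_x : \mathcal{A} \to B(H)$, $M_x(a)=x^*ax$, is compact, and $T:\mathcal{A}\to B(H)$ is an operator with $0 \leq T \leq M_x$. Then $T$ is compact.
   Context: Operators between operator algebras are bounded linear maps; $T\ge 0$ means that $T$ maps positive elements to positive elements, and $T\le S$ means $S-T\ge 0$. *)

theory Defs
  imports "HOL-Analysis.Analysis"
begin

section \<open>Complex Hilbert spaces\<close>

text \<open>
  A complex Hilbert space is a complete real inner product space carrying a compatible complex
  scalar multiplication and a sesquilinear form, linear in its first argument, whose real part is
  the real inner product.  Definiteness, \<open>\<parallel>x\<parallel>\<^sup>2 = \<langle>x, x\<rangle>\<close> and \<open>1 x = x\<close> follow from the axioms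
  of \<^class>\<open>real_inner\<close>.
\<close>

class complex_hilbert = real_inner + complete_space +
  fixes scaleC :: "complex \<Rightarrow> 'a \<Rightarrow> 'a"  (infixr "*\<^sub>C" 75)
    and cinner :: "'a \<Rightarrow> 'a \<Rightarrow> complex"
  assumes scaleC_add_right: "c *\<^sub>C (x + y) = c *\<^sub>C x + c *\<^sub>C y"
    and scaleC_add_left: "(c + d) *\<^sub>C x = c *\<^sub>C x + d *\<^sub>C x"
    and scaleC_scaleC: "c *\<^sub>C d *\<^sub>C x = (c * d) *\<^sub>C x"
    and scaleC_of_real: "complex_of_real r *\<^sub>C x = r *\<^sub>R x"
    and cinner_commute: "cinner x y = cnj (cinner y x)"
    and cinner_add_left: "cinner (x + y) z = cinner x z + cinner y z"
    and cinner_scaleC_left: "cinner (c *\<^sub>C x) y = c * cinner x y"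
    and Re_cinner: "Re (cinner x y) = inner x y"

instantiation complex :: complex_hilbert
begin

definition scaleC_complex :: "complex \<Rightarrow> complex \<Rightarrow> complex"
  where "scaleC_complex c x = c * x"

definition cinner_complex :: "complex \<Rightarrow> complex \<Rightarrow> complex"
  where "cinner_complex x y = x * cnj y"

instance
  by standard
    (auto simp: scaleC_complex_def cinner_complex_def algebra_simps scaleR_conv_of_real
      inner_complex_def)

end

lemma cinner_scaleC_right: "cinner x (c *\<^sub>C y) = cnj c * cinner x y"
  by (metis cinner_commute cinner_scaleC_left complex_cnj_mult)

lemma cinner_self: "cinner x x = of_real ((norm x)\<^sup>2)"
proof -
  have "Im (cinner x x) = 0"
    using arg_cong[OF cinner_commute[of x x], of Im] by simp
  then show ?thesis
    by (simp add: complex_eq_iff Re_cinner power2_norm_eq_inner)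
qed

lemma norm_scaleC: "norm (c *\<^sub>C x) = cmod c * norm (x :: 'h::complex_hilbert)"
proof -
  have "complex_of_real ((norm (c *\<^sub>C x))\<^sup>2) = of_real ((cmod c * norm x)\<^sup>2)"
    by (simp only: cinner_self[symmetric] cinner_scaleC_left cinner_scaleC_right)
      (simp add: cinner_self power_mult_distrib complex_norm_square del: of_real_power)
  then have "(norm (c *\<^sub>C x))\<^sup>2 = (cmod c * norm x)\<^sup>2"
    by (simp only: of_real_eq_iff)
  then show ?thesis
    by (rule power2_eq_imp_eq) simp_all
qed

lemma bounded_linear_scaleC: "bounded_linear (\<lambda>x :: 'h::complex_hilbert. c *\<^sub>C x)"
proof (rule bounded_linear_intro[where K = "cmod c"])
  show "c *\<^sub>C (r *\<^sub>R x) = r *\<^sub>R (c *\<^sub>C x)" for r and x :: 'h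
    by (simp add: scaleC_of_real[symmetric] scaleC_scaleC mult.commute)
qed (simp_all add: scaleC_add_right norm_scaleC mult.commute)

lemma cinner_inner: "cinner x y = Complex (inner x y) (inner x (\<i> *\<^sub>C y))"
  by (simp add: complex_eq_iff Re_cinner[symmetric] cinner_scaleC_right)


section \<open>Bounded operators on a complex Hilbert space\<close>

text \<open>
  The library type of bounded linear maps is real.  \<open>B(H)\<close> is the set of those members that commute
  with complex scalars; its norm and topology are those of the ambient type.
\<close>

definition bounded_operators :: "('h::complex_hilbert \<Rightarrow>\<^sub>L 'h) set"
  where "bounded_operators =
    {a. \<forall>c v. blinfun_apply a (c *\<^sub>C v) = c *\<^sub>C blinfun_apply a v}"

lift_definition scaleC_op :: "complex \<Rightarrow> ('h::complex_hilbert \<Rightarrow>\<^sub>L 'h) \<Rightarrow> ('h \<Rightarrow>\<^sub>L 'h)"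
  is "\<lambda>c a v. c *\<^sub>C a v"
  using bounded_linear_compose[OF bounded_linear_scaleC] by blast

text \<open>Meaningful on \<open>B(H)\<close>, by \<open>cinner_adjoint_op\<close> and \<open>adjoint_op_unique\<close> below.\<close>

definition adjoint_op :: "('h::complex_hilbert \<Rightarrow>\<^sub>L 'h) \<Rightarrow> ('h \<Rightarrow>\<^sub>L 'h)"
  where "adjoint_op a =
    (THE b. \<forall>u v. cinner (blinfun_apply a u) v = cinner u (blinfun_apply b v))"

lemma riesz_real:
  fixes f :: "'h::{real_inner, complete_space} \<Rightarrow> real"
  assumes "bounded_linear f"
  shows "\<exists>w. \<forall>v. f v = inner v w"
proof (cases "\<forall>v. f v = 0")
  case True
  then show ?thesis by (intro exI[of _ 0]) simp
next
  case False
  interpret f: bounded_linear f by fact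
  define C where "C = {v. f v = 1}"
  define d where "d = Inf ((\<lambda>v. (norm v)\<^sup>2) ` C)"
  from False obtain v0 where "f v0 \<noteq> 0" by blast
  then have "v0 /\<^sub>R f v0 \<in> C" by (simp add: C_def f.scaleR)
  then have ne: "C \<noteq> {}" by blast
  have bdd: "bdd_below ((\<lambda>v. (norm v)\<^sup>2) ` C)"
    by (rule bdd_belowI[of _ 0]) auto
  have d_le: "d \<le> (norm v)\<^sup>2" if "v \<in> C" for v
    unfolding d_def using that bdd by (intro cInf_lower) auto
  have "\<exists>v\<in>C. (norm v)\<^sup>2 < d + 1 / real (Suc n)" for n
  proof -
    have "Inf ((\<lambda>v. (norm v)\<^sup>2) ` C) < d + 1 / real (Suc n)" by (simp add: d_def)
    then show ?thesis using ne bdd by (subst (asm) cInf_less_iff) auto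
  qed
  then obtain s where s: "\<And>n. s n \<in> C" "\<And>n. (norm (s n))\<^sup>2 < d + 1 / real (Suc n)"
    by metis
  have est: "(norm (s m - s n))\<^sup>2 \<le> 2 * (1 / real (Suc m)) + 2 * (1 / real (Suc n))" for m n
  proof -
    have "(1/2) *\<^sub>R (s m + s n) \<in> C"
      using s(1)[of m] s(1)[of n] by (simp add: C_def f.scaleR f.add)
    from d_le[OF this] have "4 * d \<le> (norm (s m + s n))\<^sup>2"
      by (simp add: power_divide)
    moreover have "(norm (s m - s n))\<^sup>2 + (norm (s m + s n))\<^sup>2
        = 2 * (norm (s m))\<^sup>2 + 2 * (norm (s n))\<^sup>2"
      by (simp add: power2_norm_eq_inner algebra_simps)
    ultimately show ?thesis using s(2)[of m] s(2)[of n] by linarith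
  qed
  have "Cauchy s"
  proof (rule metric_CauchyI)
    fix e :: real assume e: "e > 0"
    then obtain N where N: "inverse (real (Suc N)) < e\<^sup>2 / 4"
      using reals_Archimedean[of "e\<^sup>2 / 4"] by auto
    have "dist (s m) (s n) < e" if "m \<ge> N" "n \<ge> N" for m n
    proof -
      have "1 / real (Suc m) \<le> 1 / real (Suc N)" "1 / real (Suc n) \<le> 1 / real (Suc N)"
        using that by (auto intro!: divide_left_mono)
      then have "(norm (s m - s n))\<^sup>2 < e\<^sup>2"
        using est[of m n] N by (simp add: inverse_eq_divide)
      then show ?thesis
        using e by (simp add: dist_norm power_less_imp_less_base)
    qed
    then show "\<exists>M. \<forall>m\<ge>M. \<forall>n\<ge>M. dist (s m) (s n) < e" by blast
  qed
  then obtain w where w: "s \<longlonglongrightarrow> w"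
    using Cauchy_convergent convergent_def by blast
  have "(\<lambda>n. f (s n)) \<longlonglongrightarrow> f w" using w by (rule f.tendsto)
  then have fw: "f w = 1"
    using s(1) by (simp add: C_def LIMSEQ_const_iff)
  have "(\<lambda>n. (norm (s n))\<^sup>2) \<longlonglongrightarrow> (norm w)\<^sup>2" using w by (intro tendsto_intros)
  moreover have "(\<lambda>n. d + 1 / real (Suc n)) \<longlonglongrightarrow> d + 0"
    using LIMSEQ_inverse_real_of_nat by (intro tendsto_intros) (simp add: inverse_eq_divide)
  ultimately have le: "(norm w)\<^sup>2 \<le> d + 0"
    using s(2) by (intro LIMSEQ_le[where X = "\<lambda>n. (norm (s n))\<^sup>2"]) (auto intro: less_imp_le)
  then have min: "(norm w)\<^sup>2 \<le> (norm v)\<^sup>2" if "f v = 1" for v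
    using order_trans[OF le[unfolded add_0_right] d_le[of v]] that by (simp only: C_def mem_Collect_eq)
  have orth: "inner z w = 0" if z: "f z = 0" for z
  proof (rule ccontr)
    assume nz: "inner z w \<noteq> 0"
    then have zz: "inner z z > 0" by auto
    define t where "t = - inner z w / inner z z"
    have "(norm w)\<^sup>2 \<le> (norm (w + t *\<^sub>R z))\<^sup>2"
      using z fw by (intro min) (simp add: f.add f.scaleR)
    also have "\<dots> = (norm w)\<^sup>2 + 2 * t * inner z w + t * t * inner z z"
      by (simp add: power2_norm_eq_inner inner_commute algebra_simps)
    also have "\<dots> = (norm w)\<^sup>2 - (inner z w)\<^sup>2 / inner z z"
      using zz by (simp add: t_def field_simps power2_eq_square)
    finally show False using zz nz by (simp add: field_simps)
  qed
  have w0: "inner w w \<noteq> 0" using fw f.zero by auto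
  have "f v = inner v (w /\<^sub>R inner w w)" for v
  proof -
    have "inner (v - f v *\<^sub>R w) w = 0" by (rule orth) (simp add: f.diff f.scaleR fw)
    then show ?thesis using w0 by (simp add: inner_diff_left field_simps)
  qed
  then show ?thesis by blast
qed

lemma adjoint_op_unique:
  assumes "\<And>u v. cinner (blinfun_apply a u) v = cinner u (blinfun_apply b v)"
  shows "adjoint_op a = b"
  unfolding adjoint_op_def
proof (rule the_equality)
  show "\<forall>u v. cinner (blinfun_apply a u) v = cinner u (blinfun_apply b v)"
    using assms by blast
next
  fix b' assume "\<forall>u v. cinner (blinfun_apply a u) v = cinner u (blinfun_apply b' v)"
  then have "inner u (blinfun_apply b' v) = inner u (blinfun_apply b v)" for u v
    using assms by (metis Re_cinner)
  then show "b' = b"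
    by (intro blinfun_eqI) (metis vector_eq_rdot inner_commute)
qed

lemma
  assumes a: "a \<in> bounded_operators"
  shows cinner_adjoint_op: "cinner (blinfun_apply a u) v = cinner u (blinfun_apply (adjoint_op a) v)"
    and adjoint_op_closed: "adjoint_op a \<in> bounded_operators"
proof -
  have aC: "blinfun_apply a (c *\<^sub>C x) = c *\<^sub>C blinfun_apply a x" for c x
    using a by (simp add: bounded_operators_def)
  have "\<exists>w. \<forall>u. inner (blinfun_apply a u) v = inner u w" for v
    using riesz_real[of "\<lambda>u. inner (blinfun_apply a u) v"]
    by (simp add: bounded_linear_inner_left_comp blinfun.bounded_linear_right)
  then obtain g where g: "\<And>u v. inner (blinfun_apply a u) v = inner u (g v)" by metis
  have ext: "y = z" if "\<And>u. inner u y = inner u z" for y z :: 'a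
    using that by (metis vector_eq_rdot inner_commute)
  have bl: "bounded_linear g"
  proof (rule bounded_linear_intro[where K = "norm a"])
    show "g (x + y) = g x + g y" for x y
      by (rule ext) (simp add: g[symmetric] inner_add_right)
    show "g (r *\<^sub>R x) = r *\<^sub>R g x" for r x
      by (rule ext) (simp add: g[symmetric])
    show "norm (g x) \<le> norm x * norm a" for x
    proof (cases "g x = 0")
      case False
      have "norm (g x) * norm (g x) = inner (g x) (g x)"
        by (simp add: power2_norm_eq_inner[symmetric] power2_eq_square)
      also have "\<dots> = inner (blinfun_apply a (g x)) x"
        by (simp add: g)
      also have "\<dots> \<le> norm (blinfun_apply a (g x)) * norm x"
        by (rule norm_cauchy_schwarz)
      also have "\<dots> \<le> (norm a * norm (g x)) * norm x"
        by (intro mult_right_mono norm_blinfun) simp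
      finally have "norm (g x) * norm (g x) \<le> norm (g x) * (norm x * norm a)"
        by (simp add: mult_ac)
      then show ?thesis
        using False by simp
    qed simp
  qed
  have key: "cinner (blinfun_apply a u) v = cinner u (g v)" for u v
  proof -
    have "Re (cinner (blinfun_apply a u) v) = Re (cinner u (g v))" for u
      by (simp add: Re_cinner g)
    from this[of u] this[of "\<i> *\<^sub>C u"] show ?thesis
      by (simp add: aC cinner_scaleC_left complex_eq_iff)
  qed
  have adj: "blinfun_apply (adjoint_op a) = g"
    using adjoint_op_unique[of a "Blinfun g"] key bl
    by (simp add: bounded_linear_Blinfun_apply)
  show "cinner (blinfun_apply a u) v = cinner u (blinfun_apply (adjoint_op a) v)"
    by (simp add: adj key)
  have "g (c *\<^sub>C x) = c *\<^sub>C g x" for c x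
  proof (rule ext)
    fix u
    have "cinner u (g (c *\<^sub>C x)) = cinner u (c *\<^sub>C g x)"
      by (simp add: key[symmetric] cinner_scaleC_right)
    then show "inner u (g (c *\<^sub>C x)) = inner u (c *\<^sub>C g x)"
      by (metis Re_cinner)
  qed
  then show "adjoint_op a \<in> bounded_operators"
    by (simp add: bounded_operators_def adj)
qed


section \<open>Operator algebras\<close>

definition cstar_subalgebra :: "('h::complex_hilbert \<Rightarrow>\<^sub>L 'h) set \<Rightarrow> bool"
  where "cstar_subalgebra A \<longleftrightarrow>
    A \<subseteq> bounded_operators \<and> 0 \<in> A \<and>
    (\<forall>a\<in>A. \<forall>b\<in>A. a + b \<in> A) \<and> (\<forall>c. \<forall>a\<in>A. scaleC_op c a \<in> A) \<and>
    (\<forall>a\<in>A. \<forall>b\<in>A. a o\<^sub>L b \<in> A) \<and> (\<forall>a\<in>A. adjoint_op a \<in> A) \<and> closed A"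

definition complex_subspace :: "'h::complex_hilbert set \<Rightarrow> bool"
  where "complex_subspace S \<longleftrightarrow>
    0 \<in> S \<and> (\<forall>u\<in>S. \<forall>v\<in>S. u + v \<in> S) \<and> (\<forall>c. \<forall>u\<in>S. c *\<^sub>C u \<in> S)"

definition irreducible_on :: "('h::complex_hilbert \<Rightarrow>\<^sub>L 'h) set \<Rightarrow> bool"
  where "irreducible_on A \<longleftrightarrow>
    (\<forall>S. complex_subspace S \<and> closed S \<and> (\<forall>a\<in>A. blinfun_apply a ` S \<subseteq> S)
      \<longrightarrow> S = {0} \<or> S = UNIV)"

text \<open>
  \<open>\<langle>a v, v\<rangle>\<close> is required to be real and nonnegative; the positive elements of a
  \<open>C\<^sup>*\<close>-subalgebra are the positive operators that belong to it.
\<close>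

definition positive_operator :: "('h::complex_hilbert \<Rightarrow>\<^sub>L 'h) \<Rightarrow> bool"
  where "positive_operator a \<longleftrightarrow>
    a \<in> bounded_operators \<and>
    (\<forall>v. cinner (blinfun_apply a v) v \<in> \<real> \<and> 0 \<le> Re (cinner (blinfun_apply a v) v))"


section \<open>Operators from an operator algebra to \<open>B(H)\<close>\<close>

text \<open>
  Such a map is a function on the whole type of which only the values on \<open>A\<close> matter.
\<close>

definition bounded_map_on ::
    "('h::complex_hilbert \<Rightarrow>\<^sub>L 'h) set \<Rightarrow> (('h \<Rightarrow>\<^sub>L 'h) \<Rightarrow> ('h \<Rightarrow>\<^sub>L 'h)) \<Rightarrow> bool"
  where "bounded_map_on A T \<longleftrightarrow>
    (\<forall>a\<in>A. T a \<in> bounded_operators) \<and>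
    (\<forall>a\<in>A. \<forall>b\<in>A. T (a + b) = T a + T b) \<and>
    (\<forall>c. \<forall>a\<in>A. T (scaleC_op c a) = scaleC_op c (T a)) \<and>
    (\<exists>K. \<forall>a\<in>A. norm (T a) \<le> K * norm a)"

definition compact_map_on ::
    "('h::complex_hilbert \<Rightarrow>\<^sub>L 'h) set \<Rightarrow> (('h \<Rightarrow>\<^sub>L 'h) \<Rightarrow> ('h \<Rightarrow>\<^sub>L 'h)) \<Rightarrow> bool"
  where "compact_map_on A T \<longleftrightarrow>
    bounded_map_on A T \<and> compact (closure (T ` {a \<in> A. norm a \<le> 1}))"

definition positive_map_on ::
    "('h::complex_hilbert \<Rightarrow>\<^sub>L 'h) set \<Rightarrow> (('h \<Rightarrow>\<^sub>L 'h) \<Rightarrow> ('h \<Rightarrow>\<^sub>L 'h)) \<Rightarrow> bool"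
  where "positive_map_on A T \<longleftrightarrow>
    (\<forall>a\<in>A. positive_operator a \<longrightarrow> positive_operator (T a))"

definition map_le_on ::
    "('h::complex_hilbert \<Rightarrow>\<^sub>L 'h) set \<Rightarrow> (('h \<Rightarrow>\<^sub>L 'h) \<Rightarrow> ('h \<Rightarrow>\<^sub>L 'h)) \<Rightarrow>
      (('h \<Rightarrow>\<^sub>L 'h) \<Rightarrow> ('h \<Rightarrow>\<^sub>L 'h)) \<Rightarrow> bool"
  where "map_le_on A T S \<longleftrightarrow> positive_map_on A (\<lambda>a. S a - T a)"

definition conj_map :: "('h::complex_hilbert \<Rightarrow>\<^sub>L 'h) \<Rightarrow> ('h \<Rightarrow>\<^sub>L 'h) \<Rightarrow> ('h \<Rightarrow>\<^sub>L 'h)"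
  where "conj_map x a = adjoint_op x o\<^sub>L a o\<^sub>L x"

end

theory Submission
  imports Defs
begin

text \<open>
  The key point is that \<open>x\<close> is a compact operator as soon as \<open>M\<^sub>x\<close> is compact and \<open>A \<noteq> {0}\<close>, and that
  a map dominated by \<open>M\<^sub>x\<close> factors through \<open>x\<close> on both sides in the sense of forms.

  \<^item> Domination.  For positive \<open>p\<close> in \<open>A\<close>, \<open>0 \<le> T p \<le> x\<^sup>* p x\<close>, so the Cauchy-Schwarz inequality for
    the form of \<open>T p\<close> gives \<open>\<bar>\<langle>T p u, v\<rangle>\<bar> \<le> \<parallel>p\<parallel> \<parallel>x u\<parallel> \<parallel>x v\<parallel>\<close>.  An arbitrary \<open>a\<close> in the unit ball of
    \<open>A\<close> is approximated by \<open>a e\<close> with \<open>e\<close> in \<open>A\<close>, and polarisation writes a product of two elements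
    as a combination of positive elements of bounded norm.  Hence
    \<open>\<bar>\<langle>T a u, v\<rangle>\<bar> \<le> 9 \<parallel>x u\<parallel> \<parallel>x v\<parallel>\<close> on the unit ball (\<open>dominated_form_bound\<close>).

  \<^item> Transitivity.  If \<open>A\<close> is irreducible and nonzero and \<open>\<parallel>\<xi>\<parallel> = \<parallel>\<eta>\<parallel>\<close> with \<open>\<xi> \<noteq> 0\<close>, some \<open>a\<close> in the
    unit ball of \<open>A\<close> maps \<open>\<xi>\<close> arbitrarily close to \<open>\<eta>\<close> (\<open>irreducible_approximate_transitivity\<close>).
    Without the norm bound this follows from Schur's lemma applied to the entries of the projection
    onto an invariant subspace of \<open>H \<times> H\<close>; the norm is reduced by passing from \<open>b\<close> to \<open>2 (1 + b b\<^sup>*)\<^sup>-\<^sup>1 b\<close>.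

  \<^item> Compactness of \<open>x\<close>.  For \<open>w = x v \<noteq> 0\<close> transitivity bounds \<open>\<parallel>w\<parallel> \<parallel>x h\<parallel>\<close> by twice the supremum of
    \<open>\<bar>\<langle>x\<^sup>* a x v, h\<rangle>\<bar>\<close> over the unit ball of \<open>A\<close>, and the vectors \<open>x\<^sup>* a x v\<close> form a totally
    bounded set, so \<open>x\<close> maps the unit ball to a totally bounded set
    (\<open>finite_net_if_conj_map_compact\<close>).

  By the first and third points the operators \<open>T a\<close>, for \<open>a\<close> in the unit ball, are determined up to a
  small error by their matrix entries \<open>\<langle>T a u, v\<rangle>\<close> for \<open>u\<close> and \<open>v\<close> in one finite set.  These entries
  range over a bounded set, so the operators \<open>T a\<close> form a totally bounded set.
\<close>

section \<open>Operators and their adjoints\<close>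

text \<open>Both superclasses of \<^class>\<open>banach\<close> are superclasses of \<^class>\<open>complex_hilbert\<close>; this makes the
  library's completeness of the space of bounded linear maps available.\<close>

instance complex_hilbert \<subseteq> banach ..

lemma bounded_operators_iff: "a \<in> bounded_operators \<longleftrightarrow> (\<forall>c v. blinfun_apply a (c *\<^sub>C v) = c *\<^sub>C blinfun_apply a v)"
  by (simp add: bounded_operators_def)

lemma scaleC_op_apply [simp]: "blinfun_apply (scaleC_op c a) v = c *\<^sub>C blinfun_apply a v"
  by (simp add: scaleC_op.rep_eq)

lemma scaleC_minus_one: "(- 1) *\<^sub>C (v :: 'h::complex_hilbert) = - v"
  using scaleC_of_real[of "-1" v] by simp

lemma scaleC_one [simp]: "1 *\<^sub>C (v :: 'h::complex_hilbert) = v"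
  using scaleC_of_real[of "1" v] by simp

lemma scaleC_diff_right: "c *\<^sub>C (u - v :: 'h::complex_hilbert) = c *\<^sub>C u - c *\<^sub>C v"
  by (rule bounded_linear.linear[OF bounded_linear_scaleC, THEN linear_diff])

lemma scaleC_zero_right [simp]: "c *\<^sub>C (0 :: 'h::complex_hilbert) = 0"
  by (rule bounded_linear.linear[OF bounded_linear_scaleC, THEN linear_0])

lemma scaleC_zero_left [simp]: "0 *\<^sub>C (v :: 'h::complex_hilbert) = 0"
  using norm_scaleC[of 0 v] by simp

lemma cinner_add_right: "cinner u (v + w :: 'h::complex_hilbert) = cinner u v + cinner u w"
  by (metis cinner_add_left cinner_commute complex_cnj_add)

lemma cinner_zero_right [simp]: "cinner u (0 :: 'h::complex_hilbert) = 0"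
  using cinner_add_right[of u 0 0] by simp

lemma cinner_zero_left [simp]: "cinner (0 :: 'h::complex_hilbert) u = 0"
  using cinner_add_left[of 0 0 u] by simp

lemma inner_adjoint_op:
  assumes "a \<in> bounded_operators"
  shows "inner (blinfun_apply a u) v = inner u (blinfun_apply (adjoint_op a) v)"
  by (metis Re_cinner assms cinner_adjoint_op)

lemma adjoint_op_add:
  assumes "a \<in> bounded_operators" "b \<in> bounded_operators"
  shows "adjoint_op (a + b) = adjoint_op a + adjoint_op b"
proof (rule adjoint_op_unique)
  show "cinner (blinfun_apply (a + b) u) v = cinner u (blinfun_apply (adjoint_op a + adjoint_op b) v)" for u v
    using assms by (simp add: blinfun.add_left cinner_add_left cinner_add_right cinner_adjoint_op)
qed

lemma adjoint_op_scaleC: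
  assumes "a \<in> bounded_operators"
  shows "adjoint_op (scaleC_op c a) = scaleC_op (cnj c) (adjoint_op a)"
  using assms by (intro adjoint_op_unique) (simp add: cinner_scaleC_left cinner_scaleC_right cinner_adjoint_op)

lemma adjoint_op_adjoint_op:
  assumes "a \<in> bounded_operators"
  shows "adjoint_op (adjoint_op a) = a"
  by (rule adjoint_op_unique) (metis assms cinner_adjoint_op cinner_commute)

lemma norm_le_if_inner_le:
  fixes D :: "'h::complex_hilbert \<Rightarrow>\<^sub>L 'h"
  assumes "\<And>v w. norm v \<le> 1 \<Longrightarrow> norm w \<le> 1 \<Longrightarrow> inner (blinfun_apply D v) w \<le> B" and "0 \<le> B"
  shows "norm D \<le> B"
proof (rule norm_blinfun_bound[OF \<open>0 \<le> B\<close>])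
  fix v
  let ?w = "blinfun_apply D v"
  show "norm (blinfun_apply D v) \<le> B * norm v"
  proof (cases "v = 0 \<or> ?w = 0")
    case False
    have "inner (blinfun_apply D (v /\<^sub>R norm v)) (?w /\<^sub>R norm ?w) \<le> B"
      by (rule assms) (use False in auto)
    moreover have "inner (blinfun_apply D (v /\<^sub>R norm v)) (?w /\<^sub>R norm ?w) = norm ?w / norm v"
      using False by (simp add: blinfun.scaleR_right dot_square_norm power2_eq_square field_simps)
    ultimately show ?thesis using False by (simp add: field_simps)
  qed (use assms in \<open>auto simp: blinfun.zero_right\<close>)
qed

lemma norm_adjoint_op_le:
  assumes "a \<in> bounded_operators"
  shows "norm (adjoint_op a) \<le> norm a"
proof (rule norm_le_if_inner_le)
  fix v w :: 'a assume vw: "norm v \<le> 1" "norm w \<le> 1"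
  have "inner (blinfun_apply (adjoint_op a) v) w = inner (blinfun_apply a w) v"
    using inner_adjoint_op[OF assms, of w v] by (simp add: inner_commute)
  also have "\<dots> \<le> norm (blinfun_apply a w) * norm v" by (rule norm_cauchy_schwarz)
  also have "\<dots> \<le> (norm a * norm w) * norm v" by (intro mult_right_mono norm_blinfun) auto
  also have "\<dots> \<le> (norm a * 1) * 1" using vw by (intro mult_mono) auto
  finally show "inner (blinfun_apply (adjoint_op a) v) w \<le> norm a" by simp
qed simp

section \<open>Products in a \<open>C\<^sup>*\<close>-subalgebra and approximate units\<close>

lemma cstar_subalgebraD:
  assumes "cstar_subalgebra A"
  shows cstar_bounded: "a \<in> A \<Longrightarrow> a \<in> bounded_operators"
    and cstar_zero: "0 \<in> A"
    and cstar_add: "a \<in> A \<Longrightarrow> b \<in> A \<Longrightarrow> a + b \<in> A"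
    and cstar_scaleC: "a \<in> A \<Longrightarrow> scaleC_op c a \<in> A"
    and cstar_compose: "a \<in> A \<Longrightarrow> b \<in> A \<Longrightarrow> a o\<^sub>L b \<in> A"
    and cstar_adjoint: "a \<in> A \<Longrightarrow> adjoint_op a \<in> A"
    and cstar_closed: "closed A"
  using assms unfolding cstar_subalgebra_def by blast+

lemma cstar_scaleR: 
  assumes "cstar_subalgebra A" "a \<in> A" shows "r *\<^sub>R a \<in> A"
proof -
  have "r *\<^sub>R a = scaleC_op (of_real r) a"
    by (rule blinfun_eqI) (simp add: blinfun.scaleR_left scaleC_of_real)
  then show ?thesis using assms cstar_scaleC by metis
qed

lemma cstar_diff:
  assumes "cstar_subalgebra A" "a \<in> A" "b \<in> A" shows "a - b \<in> A"
  using cstar_add[OF assms(1,2) cstar_scaleR[OF assms(1,3), of "-1"]] by simp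

text \<open>For a contraction \<open>g\<close> with adjoint \<open>f\<close> this says \<open>\<parallel>(1 - g f) w\<parallel>\<^sup>2 \<le> \<parallel>w\<parallel>\<^sup>2 - \<parallel>f w\<parallel>\<^sup>2\<close>, which does duty for
  functional calculus of \<open>1 - a\<^sup>* a\<close> below.\<close>

lemma norm_diff_adjoint_le:
  fixes f g :: "'h::real_inner \<Rightarrow>\<^sub>L 'h"
  assumes adj: "\<And>u v. inner (blinfun_apply f u) v = inner u (blinfun_apply g v)"
    and "norm g \<le> 1"
  shows "(norm (w - blinfun_apply g (blinfun_apply f w)))\<^sup>2 \<le> (norm w)\<^sup>2 - (norm (blinfun_apply f w))\<^sup>2"
proof -
  let ?fw = "blinfun_apply f w"
  have "norm (blinfun_apply g ?fw) \<le> norm g * norm ?fw" by (rule norm_blinfun)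
  also have "\<dots> \<le> 1 * norm ?fw" using assms(2) by (rule mult_right_mono) simp
  finally have le: "(norm (blinfun_apply g ?fw))\<^sup>2 \<le> (norm ?fw)\<^sup>2" by (simp add: power_mono)
  have "(norm (w - blinfun_apply g ?fw))\<^sup>2 = (norm w)\<^sup>2 - 2 * inner w (blinfun_apply g ?fw) + (norm (blinfun_apply g ?fw))\<^sup>2"
    by (simp add: power2_norm_eq_inner inner_commute algebra_simps)
  also have "inner w (blinfun_apply g ?fw) = (norm ?fw)\<^sup>2"
    by (simp add: adj[symmetric] power2_norm_eq_inner)
  finally show ?thesis using le by linarith
qed

text \<open>
  The approximate unit is \<open>u = 1 - (1 - a\<^sup>* a)\<^sup>n\<close>, which lies in \<open>A\<close> even if \<open>A\<close> has no unit.
  Put \<open>w\<^sub>k = (1 - a\<^sup>* a)\<^sup>k v\<close>.  Then \<open>\<parallel>a w\<^sub>k\<parallel>\<^sup>2 \<le> \<parallel>w\<^sub>k\<parallel>\<^sup>2 - \<parallel>w\<^sub>k\<^sub>+\<^sub>1\<parallel>\<^sup>2\<close>, and \<open>\<parallel>a w\<^sub>k\<parallel>\<close> decreases in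
  \<open>k\<close> because \<open>a w\<^sub>k\<^sub>+\<^sub>1 = (1 - a a\<^sup>*) a w\<^sub>k\<close>; summing gives \<open>n \<parallel>a w\<^sub>n\<parallel>\<^sup>2 \<le> \<parallel>v\<parallel>\<^sup>2\<close>, that is,
  \<open>\<parallel>a - a u\<parallel> \<le> 1 / sqrt n\<close>.
\<close>

lemma cstar_approximate_right_unit:
  assumes A: "cstar_subalgebra A" and a: "a \<in> A" and na: "norm a \<le> 1" and e: "0 < e"
  shows "\<exists>u\<in>A. norm u \<le> 2 \<and> norm (a - (a o\<^sub>L u)) < e"
proof -
  define b where "b = adjoint_op a o\<^sub>L a"
  define u where "u n = ((\<lambda>u. b + u - (b o\<^sub>L u)) ^^ n) 0" for n
  have u0: "u 0 = 0" and uS: "u (Suc n) = b + u n - (b o\<^sub>L u n)" for n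
    by (simp_all add: u_def)
  have aB: "a \<in> bounded_operators" by (rule cstar_bounded[OF A a])
  have bA: "b \<in> A" unfolding b_def by (intro cstar_compose[OF A] cstar_adjoint[OF A] a)
  have uA: "u n \<in> A" for n
    by (induction n) (simp_all add: u0 uS cstar_zero[OF A] cstar_diff[OF A] cstar_add[OF A] cstar_compose[OF A] bA)
  have adj: "inner (blinfun_apply a u) v = inner u (blinfun_apply (adjoint_op a) v)" for u v
    by (rule inner_adjoint_op[OF aB])
  have adj': "inner (blinfun_apply (adjoint_op a) u) v = inner u (blinfun_apply a v)" for u v
    by (metis adj inner_commute)
  have na': "norm (adjoint_op a) \<le> 1" using norm_adjoint_op_le[OF aB] na by linarith
  \<comment> \<open>the vectors \<open>w\<^sub>n\<close> are \<open>v - u n v\<close>\<close>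
  have w: "v - blinfun_apply (u (Suc n)) v = (v - blinfun_apply (u n) v) - blinfun_apply (adjoint_op a) (blinfun_apply a (v - blinfun_apply (u n) v))" for n v
    by (simp add: uS b_def blinfun.add_left blinfun.diff_left blinfun.diff_right algebra_simps)
  have est: "real n * (norm (blinfun_apply a (v - blinfun_apply (u n) v)))\<^sup>2 \<le> (norm v)\<^sup>2 - (norm (v - blinfun_apply (u n) v))\<^sup>2" for n v
  proof (induction n)
    case 0 then show ?case by (simp add: u0)
  next
    case (Suc n)
    let ?w = "v - blinfun_apply (u n) v" and ?w' = "v - blinfun_apply (u (Suc n)) v"
    have 1: "(norm ?w')\<^sup>2 \<le> (norm ?w)\<^sup>2 - (norm (blinfun_apply a ?w))\<^sup>2"
      unfolding w by (rule norm_diff_adjoint_le[OF adj na'])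
    have "(norm (blinfun_apply a ?w'))\<^sup>2 \<le> (norm (blinfun_apply a ?w))\<^sup>2"
      using norm_diff_adjoint_le[OF adj' na, of "blinfun_apply a ?w"]
      unfolding w by (subst blinfun.diff_right) (smt (verit) zero_le_power2)
    then have "real (Suc n) * (norm (blinfun_apply a ?w'))\<^sup>2 \<le> real (Suc n) * (norm (blinfun_apply a ?w))\<^sup>2"
      by (intro mult_left_mono) auto
    also have "\<dots> = real n * (norm (blinfun_apply a ?w))\<^sup>2 + (norm (blinfun_apply a ?w))\<^sup>2"
      by (simp add: algebra_simps)
    finally show ?case using 1 Suc.IH by linarith
  qed
  obtain n where n: "1 / e\<^sup>2 < real n" using reals_Archimedean2 by blast
  then have n0: "0 < real n" using e by (smt (verit) divide_nonneg_nonneg zero_le_power2)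
  have *: "1 < real n * e\<^sup>2" using n e by (simp add: field_simps)
  have "norm (a - (a o\<^sub>L u n)) \<le> 1 / sqrt (real n)"
  proof (rule norm_blinfun_bound)
    fix v
    have eq: "blinfun_apply (a - (a o\<^sub>L u n)) v = blinfun_apply a (v - blinfun_apply (u n) v)"
      by (simp add: blinfun.diff_left blinfun.diff_right)
    have "(norm (blinfun_apply (a - (a o\<^sub>L u n)) v))\<^sup>2 \<le> (norm v / sqrt (real n))\<^sup>2"
      unfolding eq using est[of n v] n0 by (simp add: power_divide field_simps) (smt (verit) zero_le_power2)
    then show "norm (blinfun_apply (a - (a o\<^sub>L u n)) v) \<le> 1 / sqrt (real n) * norm v"
      using n0 by (simp add: abs_le_square_iff[symmetric])
  qed simp
  also have "1 / sqrt (real n) < e"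
  proof -
    have "1 < (sqrt (real n) * e)\<^sup>2" using * n0 by (simp add: power_mult_distrib)
    then have "1 < sqrt (real n) * e" using e n0
      by (smt (verit) mult_nonneg_nonneg power_le_one real_sqrt_ge_zero)
    then show ?thesis using n0 by (simp add: field_simps)
  qed
  finally have 1: "norm (a - (a o\<^sub>L u n)) < e" .
  have "norm (u n) \<le> 2"
  proof (rule norm_blinfun_bound)
    fix v
    have "(norm (v - blinfun_apply (u n) v))\<^sup>2 \<le> (norm v)\<^sup>2"
      using est[of n v] n0 by (smt (verit) mult_nonneg_nonneg zero_le_power2)
    then have "norm (v - blinfun_apply (u n) v) \<le> norm v" by simp
    then show "norm (blinfun_apply (u n) v) \<le> 2 * norm v"
      using norm_triangle_ineq4[of v "v - blinfun_apply (u n) v"] by simp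
  qed simp
  then show ?thesis using 1 uA by blast
qed

section \<open>Form bounds for dominated maps\<close>

lemma positive_operator_iff:
  "positive_operator q \<longleftrightarrow> q \<in> bounded_operators \<and>
    (\<forall>v. Im (cinner (blinfun_apply q v) v) = 0 \<and> 0 \<le> inner (blinfun_apply q v) v)"
  by (auto simp: positive_operator_def Re_cinner complex_is_Real_iff)

text \<open>A complex-linear operator with real quadratic form is symmetric: evaluate the form at
  \<open>u + \<i> v\<close>.\<close>

lemma positive_operator_symmetric:
  assumes "positive_operator q"
  shows "inner (blinfun_apply q u) v = inner (blinfun_apply q v) u"
proof -
  have q: "blinfun_apply q (c *\<^sub>C v) = c *\<^sub>C blinfun_apply q v"
    and real: "Im (cinner (blinfun_apply q v) v) = 0" for c v
    using assms by (auto simp: positive_operator_iff bounded_operators_iff)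
  have "cinner (blinfun_apply q (u + \<i> *\<^sub>C v)) (u + \<i> *\<^sub>C v) =
      cinner (blinfun_apply q u) u + cinner (blinfun_apply q v) v
      + \<i> * (cinner (blinfun_apply q v) u - cinner (blinfun_apply q u) v)"
    by (simp add: blinfun.add_right q cinner_add_left cinner_add_right cinner_scaleC_left cinner_scaleC_right algebra_simps)
  from arg_cong[OF this, of Im] show ?thesis by (simp add: real Re_cinner)
qed

lemma positive_operator_Cauchy_Schwarz:
  assumes "positive_operator q"
  shows "(inner (blinfun_apply q u) v)\<^sup>2 \<le> inner (blinfun_apply q u) u * inner (blinfun_apply q v) v"
proof -
  let ?a = "inner (blinfun_apply q u) u" and ?b = "inner (blinfun_apply q u) v" and ?c = "inner (blinfun_apply q v) v"
  have pos: "0 \<le> inner (blinfun_apply q w) w" for w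
    using assms by (simp add: positive_operator_iff)
  \<comment> \<open>the form at \<open>u + t v\<close>; the choices of \<open>t\<close> below give the discriminant condition\<close>
  have quad: "0 \<le> ?a + 2 * t * ?b + t\<^sup>2 * ?c" for t
    using pos[of "u + t *\<^sub>R v"] positive_operator_symmetric[OF assms, of v u]
    by (simp add: blinfun.add_right blinfun.scaleR_right inner_add_left inner_add_right power2_eq_square algebra_simps)
  show ?thesis
  proof (cases "?c = 0")
    case True
    have "?b = 0"
    proof (rule ccontr)
      assume "?b \<noteq> 0"
      then show False using quad[of "- (?a + 1) / (2 * ?b)"] True by (simp add: field_simps)
    qed
    then show ?thesis using True by simp
  next
    case False
    then have c: "0 < ?c" using pos[of v] by linarith
    have "0 \<le> ?a - ?b\<^sup>2 / ?c"
      using quad[of "- ?b / ?c"] c by (simp add: power2_eq_square field_simps)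
    then show ?thesis using c by (simp add: field_simps)
  qed
qed

lemma positive_operator_adjoint_compose:
  assumes "a \<in> bounded_operators"
  shows "positive_operator (adjoint_op a o\<^sub>L a)"
proof -
  have "cinner (blinfun_apply (adjoint_op a) (blinfun_apply a v)) v = of_real ((norm (blinfun_apply a v))\<^sup>2)" for v
    using cinner_adjoint_op[OF adjoint_op_closed[OF assms], of "blinfun_apply a v" v]
    by (simp add: adjoint_op_adjoint_op assms cinner_self del: of_real_power)
  moreover from this have "inner (blinfun_apply (adjoint_op a) (blinfun_apply a v)) v = (norm (blinfun_apply a v))\<^sup>2" for v
    by (metis Re_cinner Re_complex_of_real)
  ultimately show ?thesis
    using assms adjoint_op_closed[OF assms] by (simp add: positive_operator_iff bounded_operators_iff del: of_real_power)
qed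

lemma bounded_map_onD:
  assumes "bounded_map_on A T"
  shows bounded_map_on_add: "a \<in> A \<Longrightarrow> b \<in> A \<Longrightarrow> T (a + b) = T a + T b"
    and bounded_map_on_scaleC: "a \<in> A \<Longrightarrow> T (scaleC_op c a) = scaleC_op c (T a)"
    and bounded_map_on_bounded_operators: "a \<in> A \<Longrightarrow> T a \<in> bounded_operators"
  using assms by (auto simp: bounded_map_on_def)

context
  fixes A :: "('h::complex_hilbert \<Rightarrow>\<^sub>L 'h) set" and x T
  assumes A: "cstar_subalgebra A"
    and x: "x \<in> bounded_operators"
    and T: "bounded_map_on A T"
    and pos: "map_le_on A (\<lambda>a. 0) T"
    and le: "map_le_on A T (conj_map x)"
begin

lemma dominated_form_bound_positive:
  assumes p: "p \<in> A" "positive_operator p"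
  shows "\<bar>inner (blinfun_apply (T p) u) v\<bar> \<le> norm p * norm (blinfun_apply x u) * norm (blinfun_apply x v)"
proof -
  have q: "positive_operator (T p)"
    using pos p by (simp add: map_le_on_def positive_map_on_def)
  have r: "positive_operator (conj_map x p - T p)"
    using le p by (simp add: map_le_on_def positive_map_on_def)
  have diag: "inner (blinfun_apply (T p) w) w \<le> norm p * (norm (blinfun_apply x w))\<^sup>2" for w
  proof -
    have "inner (blinfun_apply (T p) w) w \<le> inner (blinfun_apply (conj_map x p) w) w"
      using r by (simp add: positive_operator_iff blinfun.diff_left inner_diff_left)
    also have "\<dots> = inner (blinfun_apply p (blinfun_apply x w)) (blinfun_apply x w)"
      by (simp add: conj_map_def inner_adjoint_op[OF x] inner_commute)
    also have "\<dots> \<le> norm (blinfun_apply p (blinfun_apply x w)) * norm (blinfun_apply x w)"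
      by (rule norm_cauchy_schwarz)
    also have "\<dots> \<le> (norm p * norm (blinfun_apply x w)) * norm (blinfun_apply x w)"
      by (intro mult_right_mono norm_blinfun) auto
    finally show ?thesis by (simp add: power2_eq_square mult.assoc)
  qed
  have "(inner (blinfun_apply (T p) u) v)\<^sup>2 \<le> inner (blinfun_apply (T p) u) u * inner (blinfun_apply (T p) v) v"
    by (rule positive_operator_Cauchy_Schwarz[OF q])
  also have "\<dots> \<le> (norm p * (norm (blinfun_apply x u))\<^sup>2) * (norm p * (norm (blinfun_apply x v))\<^sup>2)"
    using q by (intro mult_mono diag) (auto simp: positive_operator_iff)
  also have "\<dots> = (norm p * norm (blinfun_apply x u) * norm (blinfun_apply x v))\<^sup>2"
    by (simp add: power2_eq_square)
  finally show ?thesis by (simp add: abs_le_square_iff[symmetric])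
qed

lemma dominated_form_bound_square:
  assumes "a \<in> A" "norm a \<le> M"
  shows "\<bar>inner (blinfun_apply (T (adjoint_op a o\<^sub>L a)) u) v\<bar>
    \<le> M\<^sup>2 * (norm (blinfun_apply x u) * norm (blinfun_apply x v))"
proof -
  have aB: "a \<in> bounded_operators" by (rule cstar_bounded[OF A assms(1)])
  have "norm (adjoint_op a o\<^sub>L a) \<le> norm (adjoint_op a) * norm a" by (rule norm_blinfun_compose)
  also have "\<dots> \<le> M * M"
    using assms(2) norm_adjoint_op_le[OF aB] by (intro mult_mono) (auto intro: order_trans[OF norm_ge_zero])
  finally have n: "norm (adjoint_op a o\<^sub>L a) \<le> M\<^sup>2" by (simp add: power2_eq_square)
  have "\<bar>inner (blinfun_apply (T (adjoint_op a o\<^sub>L a)) u) v\<bar> \<le> norm (adjoint_op a o\<^sub>L a) * norm (blinfun_apply x u) * norm (blinfun_apply x v)"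
    using assms(1) aB
    by (intro dominated_form_bound_positive cstar_compose[OF A] cstar_adjoint[OF A] positive_operator_adjoint_compose)
  also have "\<dots> \<le> M\<^sup>2 * norm (blinfun_apply x u) * norm (blinfun_apply x v)"
    using n by (intro mult_right_mono) auto
  finally show ?thesis by (simp add: mult.assoc)
qed

lemma dominated_form_bound_symmetrised:
  assumes yz: "y \<in> A" "z \<in> A" and M: "norm y + norm z \<le> M"
  shows "\<bar>inner (blinfun_apply (T ((adjoint_op z o\<^sub>L y) + (adjoint_op y o\<^sub>L z))) u) v\<bar>
    \<le> M\<^sup>2 * (norm (blinfun_apply x u) * norm (blinfun_apply x v))"
proof -
  let ?h = "(adjoint_op z o\<^sub>L y) + (adjoint_op y o\<^sub>L z)"
  let ?p = "adjoint_op (y + z) o\<^sub>L (y + z)" and ?m = "adjoint_op (y - z) o\<^sub>L (y - z)"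
  let ?C = "M\<^sup>2 * (norm (blinfun_apply x u) * norm (blinfun_apply x v))"
  have B: "y \<in> bounded_operators" "z \<in> bounded_operators" using yz cstar_bounded[OF A] by auto
  have zB: "- z \<in> bounded_operators"
    using cstar_bounded[OF A cstar_diff[OF A cstar_zero[OF A] yz(2)]] by simp
  have "adjoint_op (- z) = - adjoint_op z"
    using adjoint_op_scaleC[OF B(2), of "-1"] 
    by (metis (no_types, lifting) blinfun.minus_left blinfun_eqI complex_cnj_minus complex_cnj_one scaleC_minus_one scaleC_op_apply)
  then have ad: "adjoint_op (y - z) = adjoint_op y - adjoint_op z"
    using adjoint_op_add[OF B(1) zB] by simp
  have pm: "y + z \<in> A" "y - z \<in> A" and pmA: "?p \<in> A" "?m \<in> A" "?h \<in> A"
    using yz by (auto intro!: cstar_add[OF A] cstar_diff[OF A] cstar_compose[OF A] cstar_adjoint[OF A])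
  \<comment> \<open>polarisation, in the form \<open>(y + z)\<^sup>*(y + z) - (y - z)\<^sup>*(y - z) = 2 (z\<^sup>* y + y\<^sup>* z)\<close>\<close>
  have "?p = ?m + (?h + ?h)"
    by (rule blinfun_eqI)
      (simp add: ad adjoint_op_add B blinfun.add_left blinfun.add_right blinfun.diff_left blinfun.diff_right algebra_simps)
  then have "T ?p = T ?m + (T ?h + T ?h)"
    using pmA bounded_map_on_add[OF T] cstar_add[OF A] by metis
  then have "2 * inner (blinfun_apply (T ?h) u) v = inner (blinfun_apply (T ?p) u) v - inner (blinfun_apply (T ?m) u) v"
    by (simp add: blinfun.add_left inner_add_left)
  moreover have "\<bar>inner (blinfun_apply (T ?p) u) v\<bar> \<le> ?C"
    using pm M norm_triangle_ineq[of y z] by (intro dominated_form_bound_square) auto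
  moreover have "\<bar>inner (blinfun_apply (T ?m) u) v\<bar> \<le> ?C"
    using pm M norm_triangle_ineq4[of y z] by (intro dominated_form_bound_square) auto
  ultimately show ?thesis by linarith
qed

lemma dominated_form_bound_product:
  assumes yz: "y \<in> A" "z \<in> A" and M: "norm y + norm z \<le> M"
  shows "\<bar>inner (blinfun_apply (T (adjoint_op z o\<^sub>L y)) u) v\<bar>
    \<le> M\<^sup>2 * (norm (blinfun_apply x u) * norm (blinfun_apply x v))"
proof -
  let ?g = "adjoint_op z o\<^sub>L y" and ?w = "scaleC_op \<i> z"
  let ?h1 = "(adjoint_op z o\<^sub>L y) + (adjoint_op y o\<^sub>L z)"
  let ?h2 = "(adjoint_op ?w o\<^sub>L y) + (adjoint_op y o\<^sub>L ?w)"
  let ?C = "M\<^sup>2 * (norm (blinfun_apply x u) * norm (blinfun_apply x v))"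
  have B: "y \<in> bounded_operators" "z \<in> bounded_operators" using yz cstar_bounded[OF A] by auto
  have yB: "blinfun_apply (adjoint_op y) (c *\<^sub>C v) = c *\<^sub>C blinfun_apply (adjoint_op y) v" for c v
    using adjoint_op_closed[OF B(1)] by (simp add: bounded_operators_iff)
  have wA: "?w \<in> A" by (rule cstar_scaleC[OF A yz(2)])
  have "norm ?w \<le> norm z"
    by (rule norm_blinfun_bound) (auto simp: norm_scaleC norm_blinfun)
  then have nw: "norm y + norm ?w \<le> M" using M by linarith
  have hA: "?g \<in> A" "?h1 \<in> A" "?h2 \<in> A"
    using yz wA by (auto intro!: cstar_add[OF A] cstar_compose[OF A] cstar_adjoint[OF A])
  \<comment> \<open>\<open>2 z\<^sup>* y = (z\<^sup>* y + y\<^sup>* z) + \<i> ((\<i> z)\<^sup>* y + y\<^sup>* (\<i> z))\<close>\<close>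
  have "?g + ?g = ?h1 + scaleC_op \<i> ?h2"
    by (rule blinfun_eqI)
      (simp add: adjoint_op_scaleC B yB blinfun.add_left scaleC_add_right scaleC_scaleC scaleC_minus_one)
  then have eq: "T ?g + T ?g = T ?h1 + scaleC_op \<i> (T ?h2)"
    using hA bounded_map_on_add[OF T] bounded_map_on_scaleC[OF T] cstar_scaleC[OF A] by metis
  have "2 * inner (blinfun_apply (T ?g) u) v
      = inner (blinfun_apply (T ?g + T ?g) u) v"
    by (simp add: blinfun.add_left inner_add_left)
  also have "\<dots> = inner (blinfun_apply (T ?h1) u) v + inner (blinfun_apply (T ?h2) (\<i> *\<^sub>C u)) v"
    unfolding eq using bounded_map_on_bounded_operators[OF T hA(3)]
    by (simp add: blinfun.add_left inner_add_left bounded_operators_iff)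
  finally have eq2: "2 * inner (blinfun_apply (T ?g) u) v
      = inner (blinfun_apply (T ?h1) u) v + inner (blinfun_apply (T ?h2) (\<i> *\<^sub>C u)) v" .
  have "\<bar>inner (blinfun_apply (T ?h1) u) v\<bar> \<le> ?C"
    by (rule dominated_form_bound_symmetrised[OF yz M])
  moreover have "\<bar>inner (blinfun_apply (T ?h2) (\<i> *\<^sub>C u)) v\<bar> \<le> ?C"
    using dominated_form_bound_symmetrised[OF yz(1) wA nw, of "\<i> *\<^sub>C u" v] x
    by (simp add: bounded_operators_iff norm_scaleC)
  ultimately show ?thesis using eq2 by linarith
qed

text \<open>
  The constant \<open>9\<close> is \<open>(2 + 1)\<^sup>2\<close>: up to a small error, \<open>a\<close> is the product \<open>(a\<^sup>*)\<^sup>* u\<close> with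
  \<open>\<parallel>u\<parallel> \<le> 2\<close> and \<open>\<parallel>a\<^sup>*\<parallel> \<le> 1\<close>.
\<close>

lemma dominated_form_bound:
  assumes a: "a \<in> A" and na: "norm a \<le> 1"
  shows "\<bar>inner (blinfun_apply (T a) u) v\<bar> \<le> 9 * (norm (blinfun_apply x u) * norm (blinfun_apply x v))"
proof (rule field_le_epsilon)
  fix e :: real assume e: "0 < e"
  obtain K0 where K0: "\<And>a. a \<in> A \<Longrightarrow> norm (T a) \<le> K0 * norm a"
    using T unfolding bounded_map_on_def by blast
  define K where "K = max K0 0"
  have K: "norm (T a) \<le> K * norm a" if "a \<in> A" for a
    using K0[OF that] by (rule order_trans) (auto simp: K_def intro!: mult_right_mono)
  \<comment> \<open>the summand \<open>1\<close> avoids a division by zero\<close>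
  define d where "d = e / (K * norm u * norm v + 1)"
  have D: "0 < K * norm u * norm v + 1" by (simp add: K_def add_nonneg_pos)
  then have d: "0 < d" using e by (simp add: d_def)
  obtain y where y: "y \<in> A" "norm y \<le> 2" "norm (a - (a o\<^sub>L y)) < d"
    using cstar_approximate_right_unit[OF A a na d] by blast
  have aB: "a \<in> bounded_operators" by (rule cstar_bounded[OF A a])
  have ayA: "a o\<^sub>L y \<in> A" "a - (a o\<^sub>L y) \<in> A"
    using a y by (auto intro!: cstar_diff[OF A] cstar_compose[OF A])
  have eq: "T a = T (a o\<^sub>L y) + T (a - (a o\<^sub>L y))"
    using bounded_map_on_add[OF T ayA] by simp
  have "\<bar>inner (blinfun_apply (T (adjoint_op (adjoint_op a) o\<^sub>L y)) u) v\<bar>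
    \<le> 3\<^sup>2 * (norm (blinfun_apply x u) * norm (blinfun_apply x v))"
    using y(2) na norm_adjoint_op_le[OF aB]
    by (intro dominated_form_bound_product y(1) cstar_adjoint[OF A a]) linarith
  then have 1: "\<bar>inner (blinfun_apply (T (a o\<^sub>L y)) u) v\<bar> \<le> 9 * (norm (blinfun_apply x u) * norm (blinfun_apply x v))"
    by (simp add: adjoint_op_adjoint_op aB)
  have "\<bar>inner (blinfun_apply (T (a - (a o\<^sub>L y))) u) v\<bar> \<le> norm (blinfun_apply (T (a - (a o\<^sub>L y))) u) * norm v"
    by (rule Cauchy_Schwarz_ineq2)
  also have "\<dots> \<le> (norm (T (a - (a o\<^sub>L y))) * norm u) * norm v"
    by (intro mult_right_mono norm_blinfun) auto
  also have "\<dots> \<le> (K * norm (a - (a o\<^sub>L y)) * norm u) * norm v"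
    by (intro mult_right_mono K ayA) auto
  also have "\<dots> \<le> (K * d * norm u) * norm v"
    using y(3) by (intro mult_right_mono mult_left_mono) (auto simp: K_def)
  also have "\<dots> = d * (K * norm u * norm v)" by simp
  also have "\<dots> \<le> d * (K * norm u * norm v + 1)" using d by (intro mult_left_mono) auto
  also have "\<dots> = e" using D by (simp add: d_def)
  finally have 2: "\<bar>inner (blinfun_apply (T (a - (a o\<^sub>L y))) u) v\<bar> \<le> e" .
  show "\<bar>inner (blinfun_apply (T a) u) v\<bar> \<le> 9 * (norm (blinfun_apply x u) * norm (blinfun_apply x v)) + e"
    using 1 2 by (subst eq) (simp add: blinfun.add_left inner_add_left)
qed

end

section \<open>Finite nets\<close>

text \<open>A set that is mapped boundedly into \<open>\<real>\<^sup>I\<close>, with \<open>I\<close> finite, has finite nets for the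
  supremum distance of the coordinates: group the points by the integer parts of the coordinates
  divided by \<open>d\<close>.\<close>

lemma finite_net_of_coordinates:
  fixes f :: "'u \<Rightarrow> 'i \<Rightarrow> real"
  assumes "finite I" and bd: "\<And>u i. u \<in> X \<Longrightarrow> i \<in> I \<Longrightarrow> \<bar>f u i\<bar> \<le> B" and d: "0 < d"
  shows "\<exists>N. finite N \<and> N \<subseteq> X \<and> (\<forall>u\<in>X. \<exists>n\<in>N. \<forall>i\<in>I. \<bar>f u i - f n i\<bar> < d)"
proof -
  define g where "g u = restrict (\<lambda>i. \<lfloor>f u i / d\<rfloor>) I" for u
  have "g u \<in> (\<Pi>\<^sub>E i\<in>I. {\<lfloor>- B / d\<rfloor>..\<lfloor>B / d\<rfloor>})" if "u \<in> X" for u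
  proof -
    have "- B / d \<le> f u i / d \<and> f u i / d \<le> B / d" if "i \<in> I" for i
      using bd[OF \<open>u \<in> X\<close> that] d
      by (intro conjI divide_right_mono) (auto simp: abs_le_iff)
    then show ?thesis by (auto simp: g_def intro!: floor_mono)
  qed
  then have "g ` X \<subseteq> (\<Pi>\<^sub>E i\<in>I. {\<lfloor>- B / d\<rfloor>..\<lfloor>B / d\<rfloor>})" by blast
  then have "finite (g ` X)"
    by (rule finite_subset) (intro finite_PiE assms(1) finite_atLeastAtMost_int)
  then obtain N where N: "N \<subseteq> X" "finite N" "g ` X = g ` N"
    using finite_subset_image[of "g ` X" g X] by auto
  have "\<exists>n\<in>N. \<forall>i\<in>I. \<bar>f u i - f n i\<bar> < d" if u: "u \<in> X" for u
  proof -
    obtain n where n: "n \<in> N" "g u = g n" using N u by blast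
    have "\<bar>f u i - f n i\<bar> < d" if i: "i \<in> I" for i
    proof -
      have "\<lfloor>f u i / d\<rfloor> = \<lfloor>f n i / d\<rfloor>"
        using fun_cong[OF n(2), of i] i by (simp add: g_def)
      then have "\<bar>f u i / d - f n i / d\<bar> < 1" by linarith
      then have "\<bar>(f u i - f n i) / d\<bar> < 1" by (simp add: diff_divide_distrib)
      then show ?thesis using d by (simp add: abs_divide)
    qed
    then show ?thesis using n(1) by blast
  qed
  then show ?thesis using N by blast
qed

lemma compact_closure_if_finite_nets:
  fixes S :: "'a::banach set"
  assumes "\<And>e. 0 < e \<Longrightarrow> \<exists>N. finite N \<and> (\<forall>s\<in>S. \<exists>n\<in>N. dist s n < e)"
  shows "compact (closure S)"
  unfolding compact_eq_totally_bounded
proof (intro conjI allI impI)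
  show "complete (closure S)" by (simp add: complete_eq_closed)
  fix e :: real assume e: "0 < e"
  obtain N where N: "finite N" "\<And>s. s \<in> S \<Longrightarrow> \<exists>n\<in>N. dist s n < e / 2"
    using assms[of "e / 2"] e by auto
  have "closure S \<subseteq> (\<Union>n\<in>N. ball n e)"
  proof
    fix t assume "t \<in> closure S"
    then obtain s where s: "s \<in> S" "dist s t < e / 2"
      using e by (meson closure_approachable half_gt_zero)
    then obtain n where n: "n \<in> N" "dist s n < e / 2" using N by blast
    have "dist n t < e" using s n dist_triangle3[of n t s] by linarith
    then show "t \<in> (\<Union>n\<in>N. ball n e)" using n by auto
  qed
  then show "\<exists>k. finite k \<and> closure S \<subseteq> (\<Union>x\<in>k. ball x e)" using N by blast
qed

section \<open>Square roots and Schur's lemma\<close>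

text \<open>The iteration \<open>t \<mapsto> (1 + t\<^sup>2) / 2\<close> started at \<open>0\<close>.  It bounds the norms of the iterates and of
  their differences in the operator iteration \<open>y \<mapsto> (c + y\<^sup>2) / 2\<close> with \<open>\<parallel>c\<parallel> \<le> 1\<close>.\<close>

definition dominating_sqrt_iteration :: "nat \<Rightarrow> real"
  where "dominating_sqrt_iteration n = ((\<lambda>t. (1 + t\<^sup>2) / 2) ^^ n) 0"

lemma dominating_sqrt_iteration_Suc:
  "dominating_sqrt_iteration (Suc n) = (1 + (dominating_sqrt_iteration n)\<^sup>2) / 2"
  by (simp add: dominating_sqrt_iteration_def)

lemma dominating_sqrt_iteration_bounds:
  "0 \<le> dominating_sqrt_iteration n \<and> dominating_sqrt_iteration n \<le> 1"
proof (induction n)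
  case 0 show ?case by (simp add: dominating_sqrt_iteration_def)
next
  case (Suc n)
  then have "(dominating_sqrt_iteration n)\<^sup>2 \<le> 1" by (simp add: power_le_one)
  then show ?case by (simp add: dominating_sqrt_iteration_Suc)
qed

lemma incseq_dominating_sqrt_iteration: "incseq dominating_sqrt_iteration"
proof (rule incseq_SucI)
  show "dominating_sqrt_iteration n \<le> dominating_sqrt_iteration (Suc n)" for n
    using zero_le_power2[of "dominating_sqrt_iteration n - 1"]
    by (simp add: dominating_sqrt_iteration_Suc power2_diff)
qed

lemma Cauchy_dominating_sqrt_iteration: "Cauchy dominating_sqrt_iteration"
proof -
  obtain L where "dominating_sqrt_iteration \<longlonglongrightarrow> L"
    using incseq_convergent[OF incseq_dominating_sqrt_iteration, of 1] dominating_sqrt_iteration_bounds by blast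
  then show ?thesis by (rule LIMSEQ_imp_Cauchy)
qed

text \<open>
  The equation says \<open>(1 - y)\<^sup>2 = 1 - c\<close>, so \<open>1 - y\<close> is a square root of \<open>1 - c\<close>.  It commutes with
  everything that commutes with \<open>c\<close>, and it is positive for symmetric \<open>c\<close> since \<open>\<parallel>y\<parallel> \<le> 1\<close>.
\<close>

lemma one_minus_sqrt_exists:
  fixes c :: "'h::complex_hilbert \<Rightarrow>\<^sub>L 'h"
  assumes nc: "norm c \<le> 1"
  shows "\<exists>y. 2 *\<^sub>R y = c + (y o\<^sub>L y) \<and> norm y \<le> 1 \<and>
    (\<forall>d. d o\<^sub>L c = c o\<^sub>L d \<longrightarrow> d o\<^sub>L y = y o\<^sub>L d) \<and>
    ((\<forall>u v. inner (blinfun_apply c u) v = inner u (blinfun_apply c v)) \<longrightarrow>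
      (\<forall>u v. inner (blinfun_apply y u) v = inner u (blinfun_apply y v)))"
proof -
  define y where "y n = ((\<lambda>y. (1/2) *\<^sub>R (c + (y o\<^sub>L y))) ^^ n) 0" for n
  let ?Y = dominating_sqrt_iteration
  have y0: "y 0 = 0" and yS: "y (Suc n) = (1/2) *\<^sub>R (c + (y n o\<^sub>L y n))" for n
    by (simp_all add: y_def)
  have ny: "norm (y n) \<le> ?Y n" for n
  proof (induction n)
    case 0 then show ?case by (simp add: y0 dominating_sqrt_iteration_def)
  next
    case (Suc n)
    have "norm (c + (y n o\<^sub>L y n)) \<le> norm c + norm (y n) * norm (y n)"
      by (rule norm_triangle_le) (intro add_left_mono norm_blinfun_compose)
    also have "\<dots> \<le> 1 + ?Y n * ?Y n"
      using nc Suc.IH by (intro add_mono mult_mono) (auto intro: order_trans[OF norm_ge_zero])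
    finally show ?case by (simp add: yS dominating_sqrt_iteration_Suc power2_eq_square)
  qed
  have step: "norm (y (Suc n) - y n) \<le> ?Y (Suc n) - ?Y n" for n
  proof (induction n)
    case 0 then show ?case
      using nc by (simp add: yS y0 dominating_sqrt_iteration_def)
  next
    case (Suc n)
    let ?a = "y (Suc n)" and ?b = "y n"
    have "(1/2) *\<^sub>R (c + (p o\<^sub>L p)) - (1/2) *\<^sub>R (c + (q o\<^sub>L q))
        = (1/2) *\<^sub>R ((p o\<^sub>L (p - q)) + ((p - q) o\<^sub>L q))" for p q
      by (rule blinfun_eqI) (simp add: blinfun.add_left blinfun.diff_left blinfun.diff_right
          blinfun.scaleR_left algebra_simps)
    then have "y (Suc (Suc n)) - y (Suc n) = (1/2) *\<^sub>R ((?a o\<^sub>L (?a - ?b)) + ((?a - ?b) o\<^sub>L ?b))"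
      using yS[of "Suc n"] yS[of n] by metis
    then have "norm (y (Suc (Suc n)) - y (Suc n)) = norm ((?a o\<^sub>L (?a - ?b)) + ((?a - ?b) o\<^sub>L ?b)) / 2"
      by simp
    also have "\<dots> \<le> (norm ?a * norm (?a - ?b) + norm (?a - ?b) * norm ?b) / 2"
      by (intro divide_right_mono norm_triangle_le add_mono norm_blinfun_compose) simp
    also have "\<dots> \<le> (?Y (Suc n) * (?Y (Suc n) - ?Y n) + (?Y (Suc n) - ?Y n) * ?Y n) / 2"
      using ny Suc.IH dominating_sqrt_iteration_bounds incseq_SucD[OF incseq_dominating_sqrt_iteration]
      by (intro divide_right_mono add_mono mult_mono) (auto intro: order_trans[OF norm_ge_zero])
    also have "\<dots> = ?Y (Suc (Suc n)) - ?Y (Suc n)"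
      by (simp add: dominating_sqrt_iteration_Suc[of "Suc n"] dominating_sqrt_iteration_Suc[of n, symmetric] field_simps power2_eq_square)
        (simp add: dominating_sqrt_iteration_Suc[of n] power2_eq_square field_simps)
    finally show ?case .
  qed
  have diff: "norm (y (n + k) - y n) \<le> ?Y (n + k) - ?Y n" for n k
  proof (induction k)
    case (Suc k)
    have "norm (y (n + Suc k) - y n) \<le> norm (y (Suc (n + k)) - y (n + k)) + norm (y (n + k) - y n)"
      using norm_triangle_ineq[of "y (Suc (n + k)) - y (n + k)" "y (n + k) - y n"] by simp
    then show ?case using step[of "n + k"] Suc.IH by simp
  qed simp
  have "Cauchy y"
  proof (rule metric_CauchyI)
    fix e :: real assume "0 < e"
    then obtain M where M: "\<And>m n. m \<ge> M \<Longrightarrow> n \<ge> M \<Longrightarrow> dist (?Y m) (?Y n) < e"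
      using Cauchy_dominating_sqrt_iteration by (meson metric_CauchyD)
    have *: "dist (y m) (y n) < e" if "m \<ge> n" "n \<ge> M" for m n
    proof -
      have "dist (y m) (y n) \<le> ?Y m - ?Y n"
        using diff[of n "m - n"] that by (simp add: dist_norm)
      also have "\<dots> \<le> dist (?Y m) (?Y n)" by (simp add: dist_real_def)
      also have "\<dots> < e" using that by (intro M) auto
      finally show ?thesis .
    qed
    have "dist (y m) (y n) < e" if "m \<ge> M" "n \<ge> M" for m n
      using *[of m n] *[of n m] that by (cases "m \<ge> n") (auto simp: dist_commute)
    then show "\<exists>M. \<forall>m\<ge>M. \<forall>n\<ge>M. dist (y m) (y n) < e" by blast
  qed
  then obtain z where z: "y \<longlonglongrightarrow> z"
    using Cauchy_convergent convergent_def by blast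
  have comp: "(\<lambda>n. y n o\<^sub>L d) \<longlonglongrightarrow> (z o\<^sub>L d)" "(\<lambda>n. d o\<^sub>L y n) \<longlonglongrightarrow> (d o\<^sub>L z)" for d
    by (intro tendsto_intros z)+
  have "(\<lambda>n. 2 *\<^sub>R y (Suc n)) \<longlonglongrightarrow> 2 *\<^sub>R z"
    using LIMSEQ_Suc[OF z] by (intro tendsto_intros)
  moreover have "(\<lambda>n. 2 *\<^sub>R y (Suc n)) \<longlonglongrightarrow> c + (z o\<^sub>L z)"
    unfolding yS scaleR_scaleR by (simp, intro tendsto_intros z)
  ultimately have 1: "2 *\<^sub>R z = c + (z o\<^sub>L z)" by (rule LIMSEQ_unique)
  have 2: "norm z \<le> 1"
    using ny dominating_sqrt_iteration_bounds by (intro LIMSEQ_le_const2[OF tendsto_norm[OF z]]) (meson order_trans)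
  have 3: "d o\<^sub>L z = z o\<^sub>L d" if d: "d o\<^sub>L c = c o\<^sub>L d" for d
  proof -
    have "d o\<^sub>L y n = y n o\<^sub>L d" for n
    proof (induction n)
      case 0 show ?case by (rule blinfun_eqI) (simp add: y0 blinfun.zero_right)
    next
      case (Suc n)
      have "blinfun_apply d (blinfun_apply (y n) v) = blinfun_apply (y n) (blinfun_apply d v)"
        "blinfun_apply d (blinfun_apply c v) = blinfun_apply c (blinfun_apply d v)" for v
        using arg_cong[OF Suc.IH, of "\<lambda>f. blinfun_apply f v"] arg_cong[OF d, of "\<lambda>f. blinfun_apply f v"] by auto
      then show ?case
        by (intro blinfun_eqI) (simp add: yS blinfun.add_left blinfun.add_right blinfun.scaleR_left blinfun.scaleR_right)
    qed
    then have "(\<lambda>n. d o\<^sub>L y n) = (\<lambda>n. y n o\<^sub>L d)" by blast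
    then show ?thesis using comp(1)[of d] comp(2)[of d] by (simp only:) (rule LIMSEQ_unique)
  qed
  have 4: "inner (blinfun_apply z u) v = inner u (blinfun_apply z v)"
    if c: "\<And>u v. inner (blinfun_apply c u) v = inner u (blinfun_apply c v)" for u v
  proof -
    have "inner (blinfun_apply (y n) u) v = inner u (blinfun_apply (y n) v)" for n u v
    proof (induction n arbitrary: u v)
      case 0 show ?case unfolding y0 by simp
    next
      case (Suc n)
      have "inner (blinfun_apply (y n) (blinfun_apply (y n) u)) v = inner u (blinfun_apply (y n) (blinfun_apply (y n) v))"
        by (simp only: Suc.IH)
      then show ?case
        by (simp add: yS c blinfun.add_left blinfun.scaleR_left inner_add_left inner_add_right)
    qed
    then have "(\<lambda>n. inner (blinfun_apply (y n) u) v) = (\<lambda>n. inner u (blinfun_apply (y n) v))" by blast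
    moreover have "(\<lambda>n. inner (blinfun_apply (y n) u) v) \<longlonglongrightarrow> inner (blinfun_apply z u) v"
      "(\<lambda>n. inner u (blinfun_apply (y n) v)) \<longlonglongrightarrow> inner u (blinfun_apply z v)"
      by (intro tendsto_intros z)+
    ultimately show ?thesis by (simp only:) (rule LIMSEQ_unique)
  qed
  from 1 2 3 4 show ?thesis by blast
qed

text \<open>Membership in the commutant of \<open>A\<close> in \<open>B(H)\<close>.\<close>

definition in_commutant :: "('h::complex_hilbert \<Rightarrow>\<^sub>L 'h) set \<Rightarrow> ('h \<Rightarrow>\<^sub>L 'h) \<Rightarrow> bool"
  where "in_commutant A s \<longleftrightarrow> s \<in> bounded_operators \<and> (\<forall>a\<in>A. a o\<^sub>L s = s o\<^sub>L a)"

lemma in_commutantD: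
  assumes "in_commutant A s"
  shows "blinfun_apply s (c *\<^sub>C v) = c *\<^sub>C blinfun_apply s v"
    and "a \<in> A \<Longrightarrow> blinfun_apply a (blinfun_apply s v) = blinfun_apply s (blinfun_apply a v)"
  using assms unfolding in_commutant_def bounded_operators_iff
  by (auto dest!: bspec arg_cong[where f = "\<lambda>f. blinfun_apply f v"])

lemma irreducible_onD:
  assumes "irreducible_on A" "complex_subspace S" "closed S"
    and "\<And>a. a \<in> A \<Longrightarrow> blinfun_apply a ` S \<subseteq> S"
  shows "S = {0} \<or> S = UNIV"
  using assms unfolding irreducible_on_def by simp

lemma irreducible_kernel_cases:
  assumes irr: "irreducible_on A" and t: "in_commutant A t"
  shows "(\<forall>v. blinfun_apply t v = 0) \<or> (\<forall>v. blinfun_apply t v = 0 \<longrightarrow> v = 0)"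
proof -
  let ?S = "{v. blinfun_apply t v = 0}"
  have "complex_subspace ?S"
    using in_commutantD(1)[OF t] by (auto simp: complex_subspace_def blinfun.add_right blinfun.zero_right)
  moreover have "closed ?S"
    by (intro closed_Collect_eq continuous_intros)
  moreover have "blinfun_apply a ` ?S \<subseteq> ?S" if "a \<in> A" for a
    using in_commutantD(2)[OF t that, symmetric] by (auto simp: blinfun.zero_right)
  ultimately have "?S = {0} \<or> ?S = UNIV" by (rule irreducible_onD[OF irr])
  then show ?thesis by blast
qed

text \<open>
  Let \<open>t\<close> be \<open>s - r\<close>, rescaled to norm at most \<open>1\<close>, where \<open>r\<close> is the Rayleigh quotient of \<open>s\<close> at a
  nonzero vector \<open>u\<close>, and let \<open>q\<close> be the positive square root of \<open>t\<^sup>2\<close>.  Since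
  \<open>(q - t)(q + t) = 0\<close> and \<open>q - t\<close> is either zero or injective, \<open>q = t\<close> or \<open>q = -t\<close>.  Hence
  \<open>\<langle>q u, u\<rangle> = 0\<close>, which forces \<open>q u = 0\<close> and \<open>t u = 0\<close>; so \<open>t\<close> is not injective and vanishes.
\<close>

lemma irreducible_symmetric_commutant_scalar:
  fixes s :: "'h::complex_hilbert \<Rightarrow>\<^sub>L 'h"
  assumes irr: "irreducible_on A" and s: "in_commutant A s"
    and sym: "\<And>u v. inner (blinfun_apply s u) v = inner u (blinfun_apply s v)"
  shows "\<exists>r. \<forall>v. blinfun_apply s v = r *\<^sub>R v"
proof (cases "\<forall>v :: 'h. v = 0")
  case True
  then show ?thesis by (metis (full_types))
next
  case False
  then obtain u :: 'h where u: "u \<noteq> 0" by blast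
  define r where "r = inner (blinfun_apply s u) u / inner u u"
  define t0 where "t0 = s - r *\<^sub>R id_blinfun"
  define t where "t = t0 /\<^sub>R (norm t0 + 1)"
  have t_apply: "blinfun_apply t v = (blinfun_apply s v - r *\<^sub>R v) /\<^sub>R (norm t0 + 1)" for v
    by (simp add: t_def t0_def blinfun.diff_left blinfun.scaleR_left)
  have n0: "0 < norm t0 + 1" by (simp add: add_nonneg_pos)
  have tn: "norm t \<le> 1" using n0 by (simp add: t_def field_simps)
  have tsym: "inner (blinfun_apply t u) v = inner u (blinfun_apply t v)" for u v
    by (simp add: t_apply sym inner_diff_left inner_diff_right)
  have tu: "inner (blinfun_apply t u) u = 0"
    using u by (simp add: t_apply inner_diff_left r_def)
  define c where "c = id_blinfun - (t o\<^sub>L t)"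
  have "norm c \<le> 1"
  proof (rule norm_blinfun_bound)
    fix v
    have "(norm (blinfun_apply c v))\<^sup>2 \<le> (norm v)\<^sup>2"
      using order_trans[OF norm_diff_adjoint_le[OF tsym tn, of v], of "(norm v)\<^sup>2"]
      by (simp add: c_def blinfun.diff_left)
    then show "norm (blinfun_apply c v) \<le> 1 * norm v" by simp
  qed simp
  from one_minus_sqrt_exists[OF this] obtain y where
    y: "2 *\<^sub>R y = c + (y o\<^sub>L y)" "norm y \<le> 1"
    and ycomm: "\<And>d. d o\<^sub>L c = c o\<^sub>L d \<Longrightarrow> d o\<^sub>L y = y o\<^sub>L d" by blast
  define q where "q = id_blinfun - y"
  have comm_t: "d o\<^sub>L q = q o\<^sub>L d" if d: "d o\<^sub>L t = t o\<^sub>L d" for d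
  proof -
    have dt: "blinfun_apply d (blinfun_apply t v) = blinfun_apply t (blinfun_apply d v)" for v
      using arg_cong[OF d, of "\<lambda>f. blinfun_apply f v"] by auto
    have "d o\<^sub>L y = y o\<^sub>L d"
      by (rule ycomm) (rule blinfun_eqI, simp add: c_def dt blinfun.diff_left blinfun.diff_right)
    then have dy: "blinfun_apply d (blinfun_apply y v) = blinfun_apply y (blinfun_apply d v)" for v
      by (metis blinfun_apply_blinfun_compose)
    show ?thesis by (rule blinfun_eqI) (simp add: q_def dy blinfun.diff_left blinfun.diff_right)
  qed
  have tC: "blinfun_apply t (c *\<^sub>C v) = c *\<^sub>C blinfun_apply t v" for c v
  proof -
    have "k *\<^sub>R c *\<^sub>C v = c *\<^sub>C k *\<^sub>R v" for k :: real and v :: 'h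
      by (simp add: scaleC_of_real[symmetric] scaleC_scaleC mult.commute)
    then show ?thesis
      by (simp add: t_apply in_commutantD(1)[OF s] scaleC_diff_right scaleR_diff_right)
  qed
  have tA: "a o\<^sub>L t = t o\<^sub>L a" if "a \<in> A" for a
    by (rule blinfun_eqI) (simp add: t_apply in_commutantD(2)[OF s that] blinfun.diff_right blinfun.scaleR_right)
  have t_comm: "in_commutant A t"
    using tC tA by (simp add: in_commutant_def bounded_operators_iff)
  have qC: "blinfun_apply q (c *\<^sub>C v) = c *\<^sub>C blinfun_apply q v" for c v
  proof -
    \<comment> \<open>complex linearity of \<open>q\<close> is commutation with the complex scalars\<close>
    have "scaleC_op c id_blinfun o\<^sub>L t = t o\<^sub>L scaleC_op c id_blinfun"
      by (rule blinfun_eqI) (simp add: tC)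
    from arg_cong[OF comm_t[OF this], of "\<lambda>f. blinfun_apply f v"] show ?thesis by simp
  qed
  have qA: "a o\<^sub>L q = q o\<^sub>L a" if "a \<in> A" for a
    by (rule comm_t[OF tA[OF that]])
  have qt: "blinfun_apply t (blinfun_apply q v) = blinfun_apply q (blinfun_apply t v)" for v
    using arg_cong[OF comm_t[OF refl], of "\<lambda>f. blinfun_apply f v"] by simp
  have yy: "2 *\<^sub>R blinfun_apply y v = v - blinfun_apply t (blinfun_apply t v) + blinfun_apply y (blinfun_apply y v)" for v
    using arg_cong[OF y(1), of "\<lambda>f. blinfun_apply f v"] by (simp add: c_def blinfun.add_left blinfun.diff_left blinfun.scaleR_left)
  have qq: "blinfun_apply q (blinfun_apply q v) = blinfun_apply t (blinfun_apply t v)" for v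
    using yy[of v] by (simp add: q_def blinfun.diff_left blinfun.diff_right scaleR_2 algebra_simps)
  have qu: "blinfun_apply q u = 0" if "inner (blinfun_apply q u) u = 0"
  proof -
    have e: "inner (blinfun_apply y u) u = (norm u)\<^sup>2"
      using that by (simp add: q_def blinfun.diff_left inner_diff_left power2_norm_eq_inner)
    have "norm (blinfun_apply y u) \<le> norm y * norm u" by (rule norm_blinfun)
    also have "\<dots> \<le> 1 * norm u" using y(2) by (rule mult_right_mono) simp
    finally have "(norm (blinfun_apply y u))\<^sup>2 \<le> (norm u)\<^sup>2" by (simp add: power_mono)
    moreover have "(norm (blinfun_apply q u))\<^sup>2 = (norm u)\<^sup>2 - 2 * inner (blinfun_apply y u) u + (norm (blinfun_apply y u))\<^sup>2"
      by (simp add: q_def blinfun.diff_left power2_norm_eq_inner inner_commute algebra_simps)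
    ultimately have "(norm (blinfun_apply q u))\<^sup>2 \<le> 0" using e by linarith
    then show ?thesis by simp
  qed
  have "in_commutant A (q - t)"
    using tC qC tA qA unfolding in_commutant_def bounded_operators_iff
    by (auto simp: blinfun.diff_left scaleC_diff_right bounded_bilinear.diff_left[OF bounded_bilinear_blinfun_compose] bounded_bilinear.diff_right[OF bounded_bilinear_blinfun_compose])
  from irreducible_kernel_cases[OF irr this]
  have cases: "(\<forall>v. blinfun_apply q v = blinfun_apply t v) \<or> (\<forall>v. blinfun_apply q v = blinfun_apply t v \<longrightarrow> v = 0)"
    by (simp add: blinfun.diff_left)
  have "blinfun_apply t u = 0"
  proof (cases "\<forall>v. blinfun_apply q v = blinfun_apply t v")
    case True
    then show ?thesis using qu tu by simp
  next
    case False
    have "blinfun_apply q (blinfun_apply q v + blinfun_apply t v) = blinfun_apply t (blinfun_apply q v + blinfun_apply t v)" for v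
      by (simp add: blinfun.add_right qq qt)
    then have "blinfun_apply q v + blinfun_apply t v = 0" for v
      using cases False by blast
    then have "blinfun_apply q v = - blinfun_apply t v" for v
      by (simp add: eq_neg_iff_add_eq_0)
    then show ?thesis using qu tu by simp
  qed
  then have "\<forall>v. blinfun_apply t v = 0"
    using irreducible_kernel_cases[OF irr t_comm] u by blast
  then show ?thesis using n0 by (auto simp: t_apply)
qed

text \<open>Schur's lemma.  The commutant is closed under adjoints, so the symmetric case applies to the
  real part and the imaginary part of \<open>s\<close>.\<close>

lemma irreducible_commutant_scalar:
  fixes s :: "'h::complex_hilbert \<Rightarrow>\<^sub>L 'h"
  assumes A: "cstar_subalgebra A" and irr: "irreducible_on A" and s: "in_commutant A s"
  shows "\<exists>c. \<forall>v. blinfun_apply s v = c *\<^sub>C v"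
proof -
  have sB: "s \<in> bounded_operators" using s by (simp add: in_commutant_def)
  let ?t = "adjoint_op s"
  have tB: "?t \<in> bounded_operators" by (rule adjoint_op_closed[OF sB])
  have ext: "y = z" if "\<And>u. inner u y = inner u z" for y z :: 'h
    using that by (metis vector_eq_rdot inner_commute)
  have tA: "blinfun_apply a (blinfun_apply ?t v) = blinfun_apply ?t (blinfun_apply a v)" if a: "a \<in> A" for a v
  proof (rule ext)
    fix u
    have aB: "a \<in> bounded_operators" and a'B: "adjoint_op a \<in> bounded_operators" and a': "adjoint_op a \<in> A"
      using a cstar_bounded[OF A] cstar_adjoint[OF A] by auto
    have *: "inner u (blinfun_apply a w) = inner (blinfun_apply (adjoint_op a) u) w" for u w
      using inner_adjoint_op[OF a'B] by (simp add: adjoint_op_adjoint_op aB)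
    show "inner u (blinfun_apply a (blinfun_apply ?t v)) = inner u (blinfun_apply ?t (blinfun_apply a v))"
      by (simp add: * inner_adjoint_op[OF sB, symmetric] in_commutantD(2)[OF s a'])
  qed
  have t: "in_commutant A ?t"
    using tB tA by (auto simp: in_commutant_def intro!: blinfun_eqI)
  have tC: "blinfun_apply ?t (c *\<^sub>C v) = c *\<^sub>C blinfun_apply ?t v" for c v by (rule in_commutantD(1)[OF t])
  have sC: "blinfun_apply s (c *\<^sub>C v) = c *\<^sub>C blinfun_apply s v" for c v by (rule in_commutantD(1)[OF s])
  have aC: "blinfun_apply a (c *\<^sub>C v) = c *\<^sub>C blinfun_apply a v" if "a \<in> A" for a c v
    using cstar_bounded[OF A that] by (simp add: bounded_operators_iff)
  have adj: "inner (blinfun_apply s u) v = inner u (blinfun_apply ?t v)"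
    "inner (blinfun_apply ?t u) v = inner u (blinfun_apply s v)" for u v
    using inner_adjoint_op[OF sB] inner_adjoint_op[OF tB] by (simp_all add: adjoint_op_adjoint_op sB)
  have iadj: "inner (\<i> *\<^sub>C u) v = - inner u (\<i> *\<^sub>C v)" for u v :: 'h
    by (simp add: Re_cinner[symmetric] cinner_scaleC_left cinner_scaleC_right)
  have mult_i: "\<i> *\<^sub>C c *\<^sub>C v = c *\<^sub>C \<i> *\<^sub>C v" for c and v :: 'h by (simp add: scaleC_scaleC mult.commute)
  have "\<exists>r. \<forall>v. blinfun_apply (s + ?t) v = r *\<^sub>R v"
    by (rule irreducible_symmetric_commutant_scalar[OF irr])
      (auto simp: in_commutant_def bounded_operators_iff blinfun.add_left blinfun.add_right sC tC scaleC_add_right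
        in_commutantD(2)[OF s] tA adj inner_add_left inner_add_right intro!: blinfun_eqI)
  then obtain h where h: "\<And>v. blinfun_apply s v + blinfun_apply ?t v = h *\<^sub>R v" by (auto simp: blinfun.add_left)
  have "\<exists>r. \<forall>v. blinfun_apply (scaleC_op \<i> (s - ?t)) v = r *\<^sub>R v"
    by (rule irreducible_symmetric_commutant_scalar[OF irr])
      (auto simp: in_commutant_def bounded_operators_iff blinfun.diff_left blinfun.diff_right sC tC scaleC_diff_right
        in_commutantD(2)[OF s] tA aC adj iadj inner_diff_left inner_diff_right mult_i intro!: blinfun_eqI)
  then obtain k where k: "\<And>v. \<i> *\<^sub>C (blinfun_apply s v - blinfun_apply ?t v) = k *\<^sub>R v" by (auto simp: blinfun.diff_left)
  have "blinfun_apply s v = Complex (h / 2) (- k / 2) *\<^sub>C v" for v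
  proof -
    have "\<i> *\<^sub>C \<i> *\<^sub>C (blinfun_apply s v - blinfun_apply ?t v) = - (blinfun_apply s v - blinfun_apply ?t v)"
      by (simp only: scaleC_scaleC) (simp add: scaleC_minus_one)
    then have "blinfun_apply s v - blinfun_apply ?t v = - (\<i> *\<^sub>C k *\<^sub>R v)" by (simp add: k)
    with h[of v] have "2 *\<^sub>R blinfun_apply s v = h *\<^sub>R v - \<i> *\<^sub>C k *\<^sub>R v"
      by (simp add: scaleR_2 algebra_simps)
    then have "blinfun_apply s v = (1/2) *\<^sub>R (h *\<^sub>R v - \<i> *\<^sub>C k *\<^sub>R v)"
      by (metis scaleR_half_double scaleR_2 scaleR_right_distrib)
    also have "\<dots> = Complex (h / 2) (- k / 2) *\<^sub>C v"
    proof -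
      have "Complex (h / 2) (- k / 2) = of_real (h/2) + of_real (-1/2) * \<i> * of_real k"
        by (simp add: complex_eq_iff)
      then show ?thesis
        by (simp add: scaleC_add_left scaleC_scaleC[symmetric] scaleC_of_real scaleR_diff_right
            del: of_real_divide of_real_minus)
    qed
    finally show ?thesis .
  qed
  then show ?thesis by blast
qed

section \<open>Orthogonal projections\<close>

text \<open>The nearest point of \<open>K\<close>, obtained from a minimising sequence by the parallelogram law.\<close>

lemma orthogonal_projection_exists:
  fixes K :: "'a::{real_inner, complete_space} set"
  assumes K: "subspace K" "closed K"
  shows "\<exists>p\<in>K. \<forall>k\<in>K. inner (u - p) k = 0"
proof -
  let ?D = "(\<lambda>k. (norm (u - k))\<^sup>2) ` K"
  define d where "d = Inf ?D"
  have ne: "?D \<noteq> {}" using subspace_0[OF K(1)] by blast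
  have bdd: "bdd_below ?D" by (rule bdd_belowI[of _ 0]) auto
  have d_le: "d \<le> (norm (u - k))\<^sup>2" if "k \<in> K" for k
    unfolding d_def using that bdd by (intro cInf_lower) auto
  have "\<exists>k\<in>K. (norm (u - k))\<^sup>2 < d + inverse (real (Suc n))" for n
  proof -
    have "Inf ?D < d + inverse (real (Suc n))" by (simp add: d_def)
    then show ?thesis using ne bdd by (subst (asm) cInf_less_iff) auto
  qed
  then obtain s where s: "\<And>n. s n \<in> K" "\<And>n. (norm (u - s n))\<^sup>2 < d + inverse (real (Suc n))"
    by metis
  have est: "(norm (s m - s n))\<^sup>2 \<le> 2 * inverse (real (Suc m)) + 2 * inverse (real (Suc n))" for m n
  proof -
    have "(1/2) *\<^sub>R (s m + s n) \<in> K"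
      using s(1) K(1) by (simp add: subspace_add subspace_scale)
    from d_le[OF this] have "d \<le> (norm ((1/2) *\<^sub>R ((u - s m) + (u - s n))))\<^sup>2"
      by (simp add: algebra_simps scaleR_2[symmetric])
    then have "4 * d \<le> (norm ((u - s m) + (u - s n)))\<^sup>2" by (simp add: power_divide)
    moreover have "(norm ((u - s n) - (u - s m)))\<^sup>2 + (norm ((u - s m) + (u - s n)))\<^sup>2
        = 2 * (norm (u - s m))\<^sup>2 + 2 * (norm (u - s n))\<^sup>2"
      unfolding power2_norm_eq_inner by (simp add: inner_commute algebra_simps)
    ultimately show ?thesis using s(2)[of m] s(2)[of n] by simp
  qed
  have "Cauchy s"
  proof (rule metric_CauchyI)
    fix e :: real assume e: "e > 0"
    then obtain N where N: "inverse (real (Suc N)) < e\<^sup>2 / 4"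
      using reals_Archimedean[of "e\<^sup>2 / 4"] by auto
    have "dist (s m) (s n) < e" if "m \<ge> N" "n \<ge> N" for m n
    proof -
      have "inverse (real (Suc m)) \<le> inverse (real (Suc N))" "inverse (real (Suc n)) \<le> inverse (real (Suc N))"
        using that by (auto intro!: le_imp_inverse_le)
      then have "(norm (s m - s n))\<^sup>2 < e\<^sup>2"
        using est[of m n] N by linarith
      then show ?thesis
        using e by (simp add: dist_norm power_less_imp_less_base)
    qed
    then show "\<exists>M. \<forall>m\<ge>M. \<forall>n\<ge>M. dist (s m) (s n) < e" by blast
  qed
  then obtain p where p: "s \<longlonglongrightarrow> p"
    using Cauchy_convergent convergent_def by blast
  have pK: "p \<in> K" using K(2) s(1) p by (rule closed_sequentially)
  have "(\<lambda>n. (norm (u - s n))\<^sup>2) \<longlonglongrightarrow> (norm (u - p))\<^sup>2" using p by (intro tendsto_intros)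
  moreover have "(\<lambda>n. d + inverse (real (Suc n))) \<longlonglongrightarrow> d + 0"
    using LIMSEQ_inverse_real_of_nat by (intro tendsto_intros)
  ultimately have le: "(norm (u - p))\<^sup>2 \<le> d + 0"
    using s(2) by (intro LIMSEQ_le[where X = "\<lambda>n. (norm (u - s n))\<^sup>2"]) (auto intro: less_imp_le)
  have orth: "inner (u - p) k = 0" if k: "k \<in> K" for k
  proof (rule ccontr)
    assume nz: "inner (u - p) k \<noteq> 0"
    then have kk: "inner k k > 0" by auto
    define t where "t = inner (u - p) k / inner k k"
    have "(norm (u - p))\<^sup>2 \<le> (norm (u - (p + t *\<^sub>R k)))\<^sup>2"
      using order_trans[OF le[unfolded add_0_right] d_le[of "p + t *\<^sub>R k"]] k pK K(1)
      by (simp only: subspace_add subspace_scale)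
    also have "\<dots> = (norm ((u - p) - t *\<^sub>R k))\<^sup>2" by (simp add: algebra_simps)
    also have "\<dots> = (norm (u - p))\<^sup>2 - 2 * t * inner (u - p) k + t * t * inner k k"
    proof -
      have "(norm (a - t *\<^sub>R k))\<^sup>2 = (norm a)\<^sup>2 - 2 * t * inner a k + t * t * inner k k" for a
        by (simp add: power2_norm_eq_inner inner_diff_left inner_diff_right inner_commute algebra_simps)
      then show ?thesis .
    qed
    also have "\<dots> = (norm (u - p))\<^sup>2 - (inner (u - p) k)\<^sup>2 / inner k k"
      using kk by (simp add: t_def field_simps power2_eq_square)
    finally show False using kk nz by (simp add: field_simps)
  qed
  then show ?thesis using pK by blast
qed

lemma orthogonal_projection_operator:
  fixes K :: "'a::{real_inner, complete_space} set"
  assumes K: "subspace K" "closed K"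
  shows "\<exists>P. bounded_linear P \<and> (\<forall>u. P u \<in> K) \<and> (\<forall>u. \<forall>k\<in>K. inner (u - P u) k = 0) \<and>
    (\<forall>u. \<forall>p\<in>K. (\<forall>k\<in>K. inner (u - p) k = 0) \<longrightarrow> P u = p)"
proof -
  obtain P where P: "\<And>u. P u \<in> K" "\<And>u k. k \<in> K \<Longrightarrow> inner (u - P u) k = 0"
    using orthogonal_projection_exists[OF K] by metis
  have unique: "P u = p" if p: "p \<in> K" "\<And>k. k \<in> K \<Longrightarrow> inner (u - p) k = 0" for u p
  proof -
    have m: "P u - p \<in> K" using P(1) p(1) K(1) by (simp add: subspace_diff)
    have "inner (P u - p) (P u - p) = inner (u - p) (P u - p) - inner (u - P u) (P u - p)"
      by (simp add: inner_diff_left)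
    also have "\<dots> = 0" using p(2)[OF m] P(2)[OF m] by simp
    finally show ?thesis by simp
  qed
  have "bounded_linear P"
  proof (rule bounded_linear_intro[where K = 1])
    show "P (u + v) = P u + P v" for u v
    proof (rule unique)
      show "inner (u + v - (P u + P v)) k = 0" if "k \<in> K" for k
        using P(2)[OF that, of u] P(2)[OF that, of v] by (simp add: inner_diff_left inner_add_left)
    qed (use P(1) K(1) subspace_add in blast)
    show "P (r *\<^sub>R u) = r *\<^sub>R P u" for r u
    proof (rule unique)
      show "inner (r *\<^sub>R u - r *\<^sub>R P u) k = 0" if "k \<in> K" for k
        using P(2)[OF that, of u] by (simp add: scaleR_diff_right[symmetric])
    qed (use P(1) K(1) subspace_scale in blast)
    show "norm (P u) \<le> norm u * 1" for u
    proof -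
      have "(norm u)\<^sup>2 = (norm (P u))\<^sup>2 + (norm (u - P u))\<^sup>2 + 2 * inner (u - P u) (P u)"
        unfolding power2_norm_eq_inner by (simp add: inner_commute algebra_simps)
      then have "(norm (P u))\<^sup>2 \<le> (norm u)\<^sup>2" using P by simp
      then show ?thesis by simp
    qed
  qed
  then show ?thesis using P unique by blast
qed

lemma subspace_closure:
  fixes V :: "'a::real_normed_vector set"
  assumes "subspace V"
  shows "subspace (closure V)"
proof (rule subspaceI)
  show "0 \<in> closure V" using subspace_0[OF assms] closure_subset by blast
  fix x y assume "x \<in> closure V" "y \<in> closure V"
  then obtain f g where "\<And>n. f n \<in> V" "f \<longlonglongrightarrow> x" "\<And>n. g n \<in> V" "g \<longlonglongrightarrow> y"
    by (metis closure_sequential)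
  then have "(\<forall>n. f n + g n \<in> V) \<and> (\<lambda>n. f n + g n) \<longlonglongrightarrow> x + y"
    using assms subspace_add tendsto_add by blast
  then show "x + y \<in> closure V" unfolding closure_sequential by (intro exI[of _ "\<lambda>n. f n + g n"])
next
  fix c x assume "x \<in> closure V"
  then obtain f where "\<And>n. f n \<in> V" "f \<longlonglongrightarrow> x"
    by (metis closure_sequential)
  then have "(\<forall>n. c *\<^sub>R f n \<in> V) \<and> (\<lambda>n. c *\<^sub>R f n) \<longlonglongrightarrow> c *\<^sub>R x"
    using assms subspace_scale tendsto_scaleR[OF tendsto_const] by blast
  then show "c *\<^sub>R x \<in> closure V" unfolding closure_sequential by (intro exI[of _ "\<lambda>n. c *\<^sub>R f n"])
qed

lemma inner_closure_eq_0:
  assumes "\<And>k. k \<in> V \<Longrightarrow> inner w k = 0" and "k \<in> closure V"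
  shows "inner w k = 0"
proof -
  have "closed {k. inner w k = 0}" by (intro closed_Collect_eq continuous_intros)
  moreover have "V \<subseteq> {k. inner w k = 0}" using assms(1) by blast
  ultimately show ?thesis using closure_minimal assms(2) by blast
qed

section \<open>Approximate transitivity\<close>

lemma irreducible_nondegenerate:
  fixes A :: "('h::complex_hilbert \<Rightarrow>\<^sub>L 'h) set"
  assumes A: "cstar_subalgebra A" and irr: "irreducible_on A" and nz: "\<exists>a\<in>A. a \<noteq> 0"
    and v: "\<And>a. a \<in> A \<Longrightarrow> blinfun_apply a v = 0"
  shows "v = 0"
proof -
  let ?S = "{v. \<forall>a\<in>A. blinfun_apply a v = 0}"
  have "complex_subspace ?S"
    using cstar_bounded[OF A] by (auto simp: complex_subspace_def bounded_operators_iff blinfun.add_right blinfun.zero_right)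
  moreover have "closed ?S"
  proof -
    have "closed (\<Inter>a\<in>A. {v. blinfun_apply a v = 0})"
      by (intro closed_INT ballI closed_Collect_eq continuous_intros)
    moreover have "(\<Inter>a\<in>A. {v. blinfun_apply a v = 0}) = ?S" by blast
    ultimately show ?thesis by simp
  qed
  moreover have "blinfun_apply a ` ?S \<subseteq> ?S" if "a \<in> A" for a
    using that by (auto simp: blinfun.zero_right)
  ultimately have "?S = {0} \<or> ?S = UNIV" by (rule irreducible_onD[OF irr])
  moreover have "?S \<noteq> UNIV"
  proof
    assume U: "?S = UNIV"
    obtain a where a: "a \<in> A" "a \<noteq> 0" using nz by blast
    have "blinfun_apply a v = 0" for v using U a(1) by blast
    then show False using a(2) by (metis blinfun.zero_left blinfun_eqI)
  qed
  ultimately show ?thesis using v by blast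
qed

lemma irreducible_orthogonal_orbit:
  fixes A :: "('h::complex_hilbert \<Rightarrow>\<^sub>L 'h) set"
  assumes A: "cstar_subalgebra A" and irr: "irreducible_on A" and nz: "\<exists>a\<in>A. a \<noteq> 0"
    and \<xi>: "\<xi> \<noteq> 0" and y: "\<And>b. b \<in> A \<Longrightarrow> cinner (blinfun_apply b \<xi>) y = 0"
  shows "y = 0"
proof -
  let ?S = "{v. \<forall>b\<in>A. cinner (blinfun_apply b \<xi>) v = 0}"
  have "complex_subspace ?S"
    by (auto simp: complex_subspace_def cinner_add_right cinner_scaleC_right)
  moreover have "closed ?S"
  proof -
    have "closed (\<Inter>b\<in>A. {v. cinner (blinfun_apply b \<xi>) v = 0})"
    proof (intro closed_INT ballI)
      fix b
      have "closed {v. inner (blinfun_apply b \<xi>) v = 0 \<and> inner (blinfun_apply b \<xi>) (\<i> *\<^sub>C v) = 0}"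
        by (intro closed_Collect_conj closed_Collect_eq continuous_intros
            linear_continuous_on[OF bounded_linear_scaleC])
      then show "closed {v. cinner (blinfun_apply b \<xi>) v = 0}"
        by (simp add: cinner_inner complex_eq_iff)
    qed
    moreover have "(\<Inter>b\<in>A. {v. cinner (blinfun_apply b \<xi>) v = 0}) = ?S" by blast
    ultimately show ?thesis by simp
  qed
  moreover have "blinfun_apply a ` ?S \<subseteq> ?S" if a: "a \<in> A" for a
  proof clarify
    fix v b assume v: "\<forall>b\<in>A. cinner (blinfun_apply b \<xi>) v = 0" and b: "b \<in> A"
    have "cinner (blinfun_apply (adjoint_op a o\<^sub>L b) \<xi>) v = 0"
      using v cstar_compose[OF A cstar_adjoint[OF A a] b] by blast
    then show "cinner (blinfun_apply b \<xi>) (blinfun_apply a v) = 0"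
      using cinner_adjoint_op[OF adjoint_op_closed[OF cstar_bounded[OF A a]], of "blinfun_apply b \<xi>" v]
      by (simp add: adjoint_op_adjoint_op cstar_bounded[OF A a])
  qed
  ultimately have cases: "?S = {0} \<or> ?S = UNIV" by (rule irreducible_onD[OF irr])
  show ?thesis
  proof (cases "?S = UNIV")
    case True
    have "blinfun_apply b \<xi> = 0" if b: "b \<in> A" for b
    proof -
      have "blinfun_apply b \<xi> \<in> ?S" using True by blast
      then have "cinner (blinfun_apply b \<xi>) (blinfun_apply b \<xi>) = 0" using b by blast
      then show ?thesis by (simp add: cinner_self)
    qed
    then show ?thesis using irreducible_nondegenerate[OF A irr nz] \<xi> by blast
  next
    case False
    then show ?thesis using cases y by blast
  qed
qed

text \<open>
  The hypothesis says that \<open>(y, \<eta>)\<close> is orthogonal to \<open>K\<close>, the closure of all \<open>(b \<xi>, b z)\<close> with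
  \<open>b \<in> A\<close>.  The projection \<open>P\<close> onto \<open>K\<close> commutes with the diagonal action of \<open>A\<close>, so by Schur's
  lemma its second row is \<open>(v, w) \<mapsto> \<alpha> v + \<beta> w\<close>.  As \<open>P (\<xi>, z) = (\<xi>, z)\<close> and \<open>P (y, \<eta>) = 0\<close>, this
  gives \<open>z = \<alpha> \<xi> + \<beta> z\<close> and \<open>\<alpha> y + \<beta> \<eta> = 0\<close>, and \<open>\<beta> = 1\<close> would imply \<open>\<alpha> = 0\<close> and \<open>\<eta> = 0\<close>.
\<close>

lemma irreducible_two_vectors:
  fixes A :: "('h::complex_hilbert \<Rightarrow>\<^sub>L 'h) set"
  assumes A: "cstar_subalgebra A" and irr: "irreducible_on A" and nz: "\<exists>a\<in>A. a \<noteq> 0"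
    and \<xi>: "\<xi> \<noteq> 0" and \<eta>: "\<eta> \<noteq> 0"
    and orth: "\<And>b. b \<in> A \<Longrightarrow> cinner (blinfun_apply b \<xi>) y + cinner (blinfun_apply b z) \<eta> = 0"
  shows "\<exists>c. z = c *\<^sub>C \<xi>"
proof -
  let ?V = "(\<lambda>b. (blinfun_apply b \<xi>, blinfun_apply b z)) ` A"
  let ?K = "closure ?V"
  have "subspace ?V"
  proof (rule subspaceI)
    show "0 \<in> ?V"
      by (rule image_eqI[OF _ cstar_zero[OF A]]) (simp add: zero_prod_def)
    fix p q assume "p \<in> ?V" "q \<in> ?V"
    then obtain b c where "p = (blinfun_apply b \<xi>, blinfun_apply b z)" "b \<in> A"
      "q = (blinfun_apply c \<xi>, blinfun_apply c z)" "c \<in> A" by blast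
    then show "p + q \<in> ?V"
      by (intro image_eqI[OF _ cstar_add[OF A, of b c]]) (auto simp: blinfun.add_left)
  next
    fix r p assume "p \<in> ?V"
    then obtain b where "p = (blinfun_apply b \<xi>, blinfun_apply b z)" "b \<in> A" by blast
    then show "r *\<^sub>R p \<in> ?V"
      by (intro image_eqI[OF _ cstar_scaleR[OF A, of b r]]) (auto simp: blinfun.scaleR_left)
  qed
  then have K: "subspace ?K" "closed ?K" by (auto intro: subspace_closure)
  obtain P where "bounded_linear P \<and> (\<forall>u. P u \<in> ?K) \<and> (\<forall>u. \<forall>k\<in>?K. inner (u - P u) k = 0) \<and>
      (\<forall>u. \<forall>p\<in>?K. (\<forall>k\<in>?K. inner (u - p) k = 0) \<longrightarrow> P u = p)"
    using orthogonal_projection_operator[OF K] by (rule exE)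
  then have P: "bounded_linear P" "\<And>u. P u \<in> ?K" "\<And>u k. k \<in> ?K \<Longrightarrow> inner (u - P u) k = 0"
    and unique: "\<And>u p. p \<in> ?K \<Longrightarrow> (\<And>k. k \<in> ?K \<Longrightarrow> inner (u - p) k = 0) \<Longrightarrow> P u = p"
    by blast+
  interpret P: bounded_linear P by (rule P(1))
  \<comment> \<open>\<open>P\<close> commutes with every map that, together with its adjoint, preserves \<open>K\<close>\<close>
  have commute: "P (f u) = f (P u)"
    if lin: "bounded_linear f" and inv: "f ` ?V \<subseteq> ?V" "g ` ?V \<subseteq> ?V"
      and lin': "bounded_linear g" and adj: "\<And>u v. inner (f u) v = inner u (g v)" for f g u
  proof (rule unique)
    have *: "h ` ?K \<subseteq> ?K" if "bounded_linear h" "h ` ?V \<subseteq> ?V" for h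
      using that closure_subset[of ?V]
      by (intro image_closure_subset linear_continuous_on) auto
    show "f (P u) \<in> ?K" using *[OF lin inv(1)] P(2) by blast
    fix k assume k: "k \<in> ?K"
    have "f u - f (P u) = f (u - P u)" using lin by (simp add: bounded_linear.linear linear_diff)
    then show "inner (f u - f (P u)) k = 0"
      using P(3)[of "g k" u] *[OF lin' inv(2)] k by (auto simp: adj)
  qed
  have P_apply: "P (blinfun_apply a v, blinfun_apply a w) =
      (blinfun_apply a (fst (P (v, w))), blinfun_apply a (snd (P (v, w))))" if a: "a \<in> A" for a v w
  proof -
    let ?f = "\<lambda>a p. (blinfun_apply a (fst p), blinfun_apply a (snd p))"
    have lin: "bounded_linear (?f a)" for a :: "'h \<Rightarrow>\<^sub>L 'h"
      by (intro bounded_linear_Pair blinfun.bounded_linear_right bounded_linear_fst bounded_linear_snd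
          bounded_linear_compose[OF blinfun.bounded_linear_right])
    have inv: "?f a ` ?V \<subseteq> ?V" if "a \<in> A" for a
    proof clarify
      fix b assume "b \<in> A"
      then show "(blinfun_apply a (fst (blinfun_apply b \<xi>, blinfun_apply b z)),
          blinfun_apply a (snd (blinfun_apply b \<xi>, blinfun_apply b z))) \<in> ?V"
        by (intro image_eqI[OF _ cstar_compose[OF A that, of b]]) auto
    qed
    have "inner (?f a u) v = inner u (?f (adjoint_op a) v)" for u v
      by (simp add: inner_prod_def inner_adjoint_op[OF cstar_bounded[OF A a]])
    from commute[OF lin inv[OF a] inv[OF cstar_adjoint[OF A a]] lin this, of "(v, w)"]
    show ?thesis by simp
  qed
  have P_scaleC: "P (c *\<^sub>C v, c *\<^sub>C w) = (c *\<^sub>C fst (P (v, w)), c *\<^sub>C snd (P (v, w)))" for c v w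
  proof -
    let ?f = "\<lambda>c p. (c *\<^sub>C fst p, c *\<^sub>C snd p) :: 'h \<times> 'h"
    have lin: "bounded_linear (?f c)" for c
      by (intro bounded_linear_Pair bounded_linear_compose[OF bounded_linear_scaleC] bounded_linear_fst bounded_linear_snd)
    have inv: "?f c ` ?V \<subseteq> ?V" for c
    proof clarify
      fix b assume "b \<in> A"
      then show "(c *\<^sub>C fst (blinfun_apply b \<xi>, blinfun_apply b z),
          c *\<^sub>C snd (blinfun_apply b \<xi>, blinfun_apply b z)) \<in> ?V"
        by (intro image_eqI[OF _ cstar_scaleC[OF A, of b c]]) auto
    qed
    have "inner (?f c u) v = inner u (?f (cnj c) v)" for u v
      by (simp add: inner_prod_def Re_cinner[symmetric] cinner_scaleC_left cinner_scaleC_right)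
    from commute[OF lin inv inv lin this, of "(v, w)"] show ?thesis by simp
  qed
  have scalar: "\<exists>c. \<forall>v. snd (P (E v)) = c *\<^sub>C v"
    if E: "bounded_linear E" "\<And>c v. E (c *\<^sub>C v) = (c *\<^sub>C fst (E v), c *\<^sub>C snd (E v))"
      "\<And>a v. E (blinfun_apply a v) = (blinfun_apply a (fst (E v)), blinfun_apply a (snd (E v)))" for E
  proof -
    have bl: "bounded_linear (\<lambda>v. snd (P (E v)))"
      by (intro bounded_linear_compose[OF bounded_linear_snd] bounded_linear_compose[OF P(1)] E(1))
    let ?s = "Blinfun (\<lambda>v. snd (P (E v)))"
    have "in_commutant A ?s"
      unfolding in_commutant_def bounded_operators_iff
      by (auto simp: bounded_linear_Blinfun_apply[OF bl] E(2,3) P_scaleC P_apply intro!: blinfun_eqI)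
    from irreducible_commutant_scalar[OF A irr this] show ?thesis
      by (simp add: bounded_linear_Blinfun_apply[OF bl])
  qed
  have "\<exists>c. \<forall>v. snd (P (v, 0)) = c *\<^sub>C v"
    by (rule scalar) (auto intro: bounded_linear_Pair bounded_linear_ident bounded_linear_zero)
  moreover have "\<exists>c. \<forall>v. snd (P (0, v)) = c *\<^sub>C v"
    by (rule scalar) (auto intro: bounded_linear_Pair bounded_linear_ident bounded_linear_zero)
  ultimately obtain \<alpha> \<beta> where sc: "\<And>v. snd (P (v, 0)) = \<alpha> *\<^sub>C v" "\<And>v. snd (P (0, v)) = \<beta> *\<^sub>C v"
    by blast
  have snd_P: "snd (P (v, w)) = \<alpha> *\<^sub>C v + \<beta> *\<^sub>C w" for v w
    using P.add[of "(v, 0)" "(0, w)"] by (simp add: sc)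
  have 1: "P (y, \<eta>) = 0"
  proof (rule unique)
    show "0 \<in> ?K" using subspace_0[OF K(1)] .
    have *: "inner (y, \<eta>) k = 0" if k: "k \<in> ?V" for k
    proof -
      obtain b where b: "b \<in> A" "k = (blinfun_apply b \<xi>, blinfun_apply b z)" using k by blast
      have "inner (blinfun_apply b \<xi>) y + inner (blinfun_apply b z) \<eta> = 0"
        using arg_cong[OF orth[OF b(1)], of Re] by (simp add: Re_cinner)
      then show ?thesis by (simp add: b(2) inner_commute)
    qed
    show "inner ((y, \<eta>) - 0) k = 0" if "k \<in> ?K" for k
      using inner_closure_eq_0[OF * that] by simp
  qed
  \<comment> \<open>the residual \<open>(\<xi>, z) - P (\<xi>, z)\<close> is annihilated by \<open>A\<close>\<close>
  have 2: "P (\<xi>, z) = (\<xi>, z)"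
  proof -
    have "P (blinfun_apply a \<xi>, blinfun_apply a z) = (blinfun_apply a \<xi>, blinfun_apply a z)" if "a \<in> A" for a
      by (rule unique) (use that closure_subset[of ?V] in auto)
    then have "blinfun_apply a (\<xi> - fst (P (\<xi>, z))) = 0" "blinfun_apply a (z - snd (P (\<xi>, z))) = 0" if "a \<in> A" for a
      using P_apply[OF that, of \<xi> z] that by (simp_all add: blinfun.diff_right)
    then have "\<xi> - fst (P (\<xi>, z)) = 0" "z - snd (P (\<xi>, z)) = 0"
      using irreducible_nondegenerate[OF A irr nz] by blast+
    then show ?thesis by (simp add: prod_eq_iff)
  qed
  have e1: "\<alpha> *\<^sub>C y + \<beta> *\<^sub>C \<eta> = 0" using snd_P[of y \<eta>] by (simp add: 1)
  have e2: "z = \<alpha> *\<^sub>C \<xi> + \<beta> *\<^sub>C z" using snd_P[of \<xi> z] by (simp add: 2)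
  have "\<beta> \<noteq> 1"
  proof
    assume b: "\<beta> = 1"
    then have "\<alpha> *\<^sub>C \<xi> = 0" using e2 by simp
    then have "\<alpha> = 0" using \<xi> norm_scaleC[of \<alpha> \<xi>] by simp
    then show False using e1 b \<eta> by simp
  qed
  moreover have "(1 - \<beta>) *\<^sub>C z = \<alpha> *\<^sub>C \<xi>"
  proof -
    have "(1 - \<beta>) *\<^sub>C z + \<beta> *\<^sub>C z = \<alpha> *\<^sub>C \<xi> + \<beta> *\<^sub>C z"
      using e2 by (simp add: scaleC_add_left[symmetric])
    then show ?thesis by simp
  qed
  then have "inverse (1 - \<beta>) *\<^sub>C (1 - \<beta>) *\<^sub>C z = inverse (1 - \<beta>) *\<^sub>C \<alpha> *\<^sub>C \<xi>" by simp
  ultimately have "z = (inverse (1 - \<beta>) * \<alpha>) *\<^sub>C \<xi>"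
    by (simp add: scaleC_scaleC)
  then show ?thesis by blast
qed

text \<open>
  The vector \<open>(\<eta>, \<xi>)\<close> lies in the closure of the real subspace of all \<open>(b \<xi>, b\<^sup>* \<eta>)\<close>: a vector
  \<open>(y, z)\<close> orthogonal to that subspace satisfies \<open>\<langle>b \<xi>, y\<rangle> + \<langle>b z, \<eta>\<rangle> = 0\<close> for all \<open>b\<close>, so
  \<open>z = c \<xi>\<close> and \<open>y = - cnj c \<eta>\<close>, which is orthogonal to \<open>(\<eta>, \<xi>)\<close> because \<open>\<parallel>\<xi>\<parallel> = \<parallel>\<eta>\<parallel>\<close>.
  Control of \<open>b\<^sup>*\<close> as well as \<open>b\<close> is what makes the subsequent norm reduction work.
\<close>

lemma irreducible_symmetric_transitivity:
  fixes A :: "('h::complex_hilbert \<Rightarrow>\<^sub>L 'h) set"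
  assumes A: "cstar_subalgebra A" and irr: "irreducible_on A" and nz: "\<exists>a\<in>A. a \<noteq> 0"
    and \<xi>: "\<xi> \<noteq> 0" and eq: "norm \<xi> = norm \<eta>" and e: "0 < e"
  shows "\<exists>b\<in>A. norm (blinfun_apply b \<xi> - \<eta>) < e \<and> norm (blinfun_apply (adjoint_op b) \<eta> - \<xi>) < e"
proof -
  let ?V = "(\<lambda>b. (blinfun_apply b \<xi>, blinfun_apply (adjoint_op b) \<eta>)) ` A"
  let ?K = "closure ?V"
  have \<eta>: "\<eta> \<noteq> 0" using \<xi> eq by auto
  have AB: "b \<in> bounded_operators" if "b \<in> A" for b using cstar_bounded[OF A that] .
  have "subspace ?V"
  proof (rule subspaceI)
    have "adjoint_op 0 = (0 :: 'h \<Rightarrow>\<^sub>L 'h)"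
      by (rule adjoint_op_unique) simp
    then show "0 \<in> ?V"
      by (intro image_eqI[OF _ cstar_zero[OF A]]) (simp add: zero_prod_def)
    fix p q assume "p \<in> ?V" "q \<in> ?V"
    then obtain b c where "p = (blinfun_apply b \<xi>, blinfun_apply (adjoint_op b) \<eta>)" "b \<in> A"
      "q = (blinfun_apply c \<xi>, blinfun_apply (adjoint_op c) \<eta>)" "c \<in> A" by blast
    then show "p + q \<in> ?V"
      by (intro image_eqI[OF _ cstar_add[OF A, of b c]]) (auto simp: blinfun.add_left adjoint_op_add AB)
  next
    fix r p assume "p \<in> ?V"
    then obtain b where b: "p = (blinfun_apply b \<xi>, blinfun_apply (adjoint_op b) \<eta>)" "b \<in> A" by blast
    then show "r *\<^sub>R p \<in> ?V"
      using adjoint_op_scaleC[OF AB[OF b(2)], of "of_real r"]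
      by (intro image_eqI[OF _ cstar_scaleC[OF A b(2), of "of_real r"]]) (auto simp: scaleC_of_real)
  qed
  then have K: "subspace ?K" "closed ?K" by (auto intro: subspace_closure)
  obtain p where p: "p \<in> ?K" and orth: "\<And>k. k \<in> ?K \<Longrightarrow> inner ((\<eta>, \<xi>) - p) k = 0"
    using orthogonal_projection_exists[OF K] by blast
  obtain y z where yz: "(\<eta>, \<xi>) - p = (y, z)" by fastforce
  have o1: "inner y (blinfun_apply b \<xi>) + inner z (blinfun_apply (adjoint_op b) \<eta>) = 0" if "b \<in> A" for b
    using orth[of "(blinfun_apply b \<xi>, blinfun_apply (adjoint_op b) \<eta>)"] that closure_subset[of ?V]
    by (auto simp: yz)
  have o2: "Re (cinner (blinfun_apply b \<xi>) y + cinner (blinfun_apply b z) \<eta>) = 0" if "b \<in> A" for b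
    using o1[OF that] inner_adjoint_op[OF AB[OF that], of z \<eta>] by (simp add: Re_cinner inner_commute)
  \<comment> \<open>the imaginary part is, up to sign, the real part for \<open>\<i> b\<close>\<close>
  have o3: "cinner (blinfun_apply b \<xi>) y + cinner (blinfun_apply b z) \<eta> = 0" if "b \<in> A" for b
    using o2[OF that] o2[OF cstar_scaleC[OF A that, of \<i>]] by (simp add: complex_eq_iff cinner_scaleC_left)
  obtain c where c: "z = c *\<^sub>C \<xi>"
    using irreducible_two_vectors[OF A irr nz \<xi> \<eta> o3] by blast
  have "y + cnj c *\<^sub>C \<eta> = 0"
  proof (rule irreducible_orthogonal_orbit[OF A irr nz \<xi>])
    fix b assume b: "b \<in> A"
    then have "blinfun_apply b (c *\<^sub>C \<xi>) = c *\<^sub>C blinfun_apply b \<xi>"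
      using AB by (simp add: bounded_operators_iff)
    then show "cinner (blinfun_apply b \<xi>) (y + cnj c *\<^sub>C \<eta>) = 0"
      using o3[OF b] by (simp add: c cinner_add_right cinner_scaleC_left cinner_scaleC_right)
  qed
  then have y: "y = - (cnj c *\<^sub>C \<eta>)" by (simp add: eq_neg_iff_add_eq_0)
  have "inner (cnj c *\<^sub>C \<eta>) \<eta> = Re c * (norm \<eta>)\<^sup>2" "inner (c *\<^sub>C \<xi>) \<xi> = Re c * (norm \<xi>)\<^sup>2"
    by (simp_all add: Re_cinner[symmetric] cinner_scaleC_left cinner_self del: of_real_power)
  then have "inner (y, z) (\<eta>, \<xi>) = 0"
    by (simp add: y c eq)
  moreover have "inner (y, z) p = 0" using orth[OF p] yz by simp
  ultimately have "inner (y, z) ((\<eta>, \<xi>) - p) = 0" by (simp only: inner_diff_right)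
  then have "(y, z) = 0" unfolding yz by (simp only: inner_eq_zero_iff)
  then have "p = (\<eta>, \<xi>)" using yz by simp
  then obtain b where b: "b \<in> A" and d: "dist (blinfun_apply b \<xi>, blinfun_apply (adjoint_op b) \<eta>) (\<eta>, \<xi>) < e"
    using p e by (auto simp: closure_approachable)
  have "dist (blinfun_apply b \<xi>) \<eta> < e" "dist (blinfun_apply (adjoint_op b) \<eta>) \<xi> < e"
    using le_less_trans[OF dist_fst_le d] le_less_trans[OF dist_snd_le d] by simp_all
  then show ?thesis using b by (auto simp: dist_norm)
qed

text \<open>
  Formally \<open>g = (1 + b b\<^sup>*)\<^sup>-\<^sup>1 b\<close>.  It is the fixed point of \<open>g \<mapsto> g + t (b - g - b b\<^sup>* g)\<close>, which for
  small \<open>t > 0\<close> contracts the closed set \<open>A\<close> because \<open>0 \<le> 1 - t (1 + b b\<^sup>*) \<le> 1 - t\<close>.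
\<close>

lemma cstar_resolvent_exists:
  fixes A :: "('h::complex_hilbert \<Rightarrow>\<^sub>L 'h) set"
  assumes A: "cstar_subalgebra A" and b: "b \<in> A"
  shows "\<exists>g\<in>A. g + (b o\<^sub>L (adjoint_op b o\<^sub>L g)) = b"
proof -
  define t where "t = 1 / (2 + (norm b)\<^sup>2)"
  have p: "0 < 2 + (norm b)\<^sup>2" by (simp add: add_pos_nonneg)
  have t: "0 < t" "t * (norm b)\<^sup>2 = 1 - 2 * t" using p by (simp_all add: t_def field_simps)
  have t1: "t \<le> 1/2" using t mult_nonneg_nonneg[of t "(norm b)\<^sup>2"] by simp
  let ?b' = "adjoint_op b"
  have bB: "b \<in> bounded_operators" by (rule cstar_bounded[OF A b])
  define F where "F g = g + t *\<^sub>R (b - g - (b o\<^sub>L (?b' o\<^sub>L g)))" for g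
  have contr: "dist (F g) (F h) \<le> (1 - t) * dist g h" for g h
    unfolding dist_norm
  proof (rule norm_blinfun_bound)
    show "0 \<le> (1 - t) * norm (g - h)" using t1 by simp
    fix v
    define w where "w = blinfun_apply (g - h) v"
    let ?s = "blinfun_apply ?b' w"
    have F: "blinfun_apply (F g - F h) v = (1 - t) *\<^sub>R w - t *\<^sub>R blinfun_apply b ?s"
      by (simp add: F_def w_def blinfun.add_left blinfun.diff_left blinfun.diff_right blinfun.scaleR_left algebra_simps)
    have "norm (blinfun_apply b ?s) \<le> norm b * norm ?s" by (rule norm_blinfun)
    then have "(norm (blinfun_apply b ?s))\<^sup>2 \<le> (norm b)\<^sup>2 * (norm ?s)\<^sup>2"
      by (metis norm_ge_zero power_mono power_mult_distrib)
    then have "t * t * (norm (blinfun_apply b ?s))\<^sup>2 \<le> t * t * ((norm b)\<^sup>2 * (norm ?s)\<^sup>2)"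
      using t by (intro mult_left_mono) auto
    also have "\<dots> = t * (1 - 2 * t) * (norm ?s)\<^sup>2" by (simp add: t(2)[symmetric])
    also have "\<dots> \<le> 2 * t * (1 - t) * (norm ?s)\<^sup>2" using t t1 by (intro mult_right_mono) (auto simp: algebra_simps)
    finally have *: "t * t * (norm (blinfun_apply b ?s))\<^sup>2 \<le> 2 * t * (1 - t) * (norm ?s)\<^sup>2" .
    have s: "inner w (blinfun_apply b ?s) = (norm ?s)\<^sup>2"
      using inner_adjoint_op[OF bB, of ?s w] by (simp add: inner_commute power2_norm_eq_inner)
    have "(norm ((1 - t) *\<^sub>R w - t *\<^sub>R blinfun_apply b ?s))\<^sup>2
        = (1 - t)\<^sup>2 * (norm w)\<^sup>2 - 2 * t * (1 - t) * inner w (blinfun_apply b ?s) + t * t * (norm (blinfun_apply b ?s))\<^sup>2"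
      unfolding power2_norm_eq_inner by (simp add: inner_diff_left inner_diff_right inner_commute power2_eq_square algebra_simps)
    also have "\<dots> \<le> ((1 - t) * norm w)\<^sup>2" using * by (simp add: s power_mult_distrib)
    finally have "norm (blinfun_apply (F g - F h) v) \<le> (1 - t) * norm w"
      unfolding F by (rule power2_le_imp_le) (use t1 in simp)
    also have "\<dots> \<le> (1 - t) * (norm (g - h) * norm v)"
      unfolding w_def using t1 by (intro mult_left_mono norm_blinfun) auto
    finally show "norm (blinfun_apply (F g - F h) v) \<le> (1 - t) * norm (g - h) * norm v" by simp
  qed
  have "\<exists>!g\<in>A. F g = g"
  proof (rule Banach_fix[where c = "1 - t"])
    show "complete A" using cstar_closed[OF A] by (simp add: complete_eq_closed)
    show "A \<noteq> {}" using b by blast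
    show "F ` A \<subseteq> A"
      using b by (auto simp: F_def intro!: cstar_add[OF A] cstar_scaleR[OF A] cstar_diff[OF A] cstar_compose[OF A] cstar_adjoint[OF A])
  qed (use t t1 contr in auto)
  then obtain g where g: "g \<in> A" "F g = g" by blast
  then have "b - g - (b o\<^sub>L (?b' o\<^sub>L g)) = 0" using t by (simp add: F_def)
  then have "g + (b o\<^sub>L (?b' o\<^sub>L g)) = b" by (simp add: algebra_simps)
  then show ?thesis using g(1) by blast
qed

text \<open>
  A form of Kadison's transitivity theorem with norm control.  Take \<open>b\<close> in \<open>A\<close> with \<open>b \<xi>\<close> close to
  \<open>\<eta>\<close> and \<open>b\<^sup>* \<eta>\<close> close to \<open>\<xi>\<close>, and put \<open>a = 2 (1 + b b\<^sup>*)\<^sup>-\<^sup>1 b\<close>.  This is a contraction since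
  \<open>2 s / (1 + s\<^sup>2) \<le> 1\<close>, and \<open>a \<xi>\<close> is close to \<open>\<eta>\<close>: if both approximations were exact, then
  \<open>(1 + b b\<^sup>*) \<eta> = \<eta> + b \<xi> = 2 b \<xi>\<close>.
\<close>

lemma irreducible_approximate_transitivity:
  fixes A :: "('h::complex_hilbert \<Rightarrow>\<^sub>L 'h) set"
  assumes A: "cstar_subalgebra A" and irr: "irreducible_on A" and nz: "\<exists>a\<in>A. a \<noteq> 0"
    and \<xi>: "\<xi> \<noteq> 0" and eq: "norm \<xi> = norm \<eta>" and e: "0 < e"
  shows "\<exists>a\<in>A. norm a \<le> 1 \<and> norm (blinfun_apply a \<xi> - \<eta>) \<le> e"
proof -
  have e2: "0 < e / 2" using e by simp
  obtain b where b: "b \<in> A" "norm (blinfun_apply b \<xi> - \<eta>) < e / 2" "norm (blinfun_apply (adjoint_op b) \<eta> - \<xi>) < e / 2"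
    using irreducible_symmetric_transitivity[OF A irr nz \<xi> eq e2] by blast
  have bB: "b \<in> bounded_operators" by (rule cstar_bounded[OF A b(1)])
  let ?b' = "adjoint_op b"
  obtain g where g: "g \<in> A" "g + (b o\<^sub>L (?b' o\<^sub>L g)) = b"
    using cstar_resolvent_exists[OF A b(1)] by blast
  have g_apply: "blinfun_apply g v + blinfun_apply b (blinfun_apply ?b' (blinfun_apply g v)) = blinfun_apply b v" for v
    using arg_cong[OF g(2), of "\<lambda>f. blinfun_apply f v"] by (simp add: blinfun.add_left)
  have form: "inner (w + blinfun_apply b (blinfun_apply ?b' w)) w = (norm w)\<^sup>2 + (norm (blinfun_apply ?b' w))\<^sup>2" for w
    using inner_adjoint_op[OF bB, of "blinfun_apply ?b' w" w] by (simp add: inner_add_left power2_norm_eq_inner)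
  have "norm (2 *\<^sub>R g) \<le> 1"
  proof (rule norm_blinfun_bound)
    fix v
    let ?w = "blinfun_apply g v"
    let ?s = "norm (blinfun_apply ?b' ?w)"
    have "(norm ?w)\<^sup>2 + ?s\<^sup>2 = inner v (blinfun_apply ?b' ?w)"
      using form[of ?w] by (simp add: g_apply inner_adjoint_op[OF bB])
    also have "\<dots> \<le> norm v * ?s" by (rule norm_cauchy_schwarz)
    also have "\<dots> \<le> (norm v / 2)\<^sup>2 + ?s\<^sup>2"
      using zero_le_power2[of "norm v / 2 - ?s"] by (simp add: power2_diff)
    finally have "(norm ?w)\<^sup>2 \<le> (norm v / 2)\<^sup>2" by simp
    then have "norm ?w \<le> norm v / 2" by (rule power2_le_imp_le) simp
    then show "norm (blinfun_apply (2 *\<^sub>R g) v) \<le> 1 * norm v" by (simp add: blinfun.scaleR_left)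
  qed simp
  moreover have "norm (blinfun_apply (2 *\<^sub>R g) \<xi> - \<eta>) \<le> e"
  proof -
    define e1 where "e1 = blinfun_apply b \<xi> - \<eta>"
    define e2 where "e2 = blinfun_apply ?b' \<eta> - \<xi>"
    define h where "h = blinfun_apply (2 *\<^sub>R g) \<xi> - \<eta>"
    let ?s = "norm (blinfun_apply ?b' h)"
    \<comment> \<open>\<open>(1 + b b\<^sup>*) h = e1 - b e2\<close>; pairing with \<open>h\<close> involves only \<open>b\<^sup>* h\<close>, so \<open>\<parallel>b\<parallel>\<close> does not enter\<close>
    have "h + blinfun_apply b (blinfun_apply ?b' h)
        = 2 *\<^sub>R (blinfun_apply g \<xi> + blinfun_apply b (blinfun_apply ?b' (blinfun_apply g \<xi>)))
          - \<eta> - blinfun_apply b (blinfun_apply ?b' \<eta>)"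
      by (simp add: h_def blinfun.scaleR_left blinfun.scaleR_right blinfun.diff_right algebra_simps)
    also have "\<dots> = e1 - blinfun_apply b e2"
      unfolding g_apply by (simp add: e1_def e2_def blinfun.diff_right scaleR_2)
    finally have "(norm h)\<^sup>2 + ?s\<^sup>2 = inner (e1 - blinfun_apply b e2) h" using form[of h] by simp
    also have "\<dots> = inner e1 h - inner e2 (blinfun_apply ?b' h)"
      by (simp add: inner_diff_left inner_adjoint_op[OF bB])
    also have "\<dots> \<le> norm e1 * norm h + norm e2 * ?s"
      using norm_cauchy_schwarz[of e1 h] Cauchy_Schwarz_ineq2[of e2 "blinfun_apply ?b' h"] by linarith
    also have "\<dots> \<le> e / 2 * norm h + e / 2 * ?s"
      using b by (intro add_mono mult_right_mono) (auto simp: e1_def e2_def)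
    finally have *: "(norm h)\<^sup>2 + ?s\<^sup>2 \<le> e / 2 * norm h + e / 2 * ?s" .
    have "e / 2 * ?s \<le> ?s\<^sup>2 + e\<^sup>2 / 16"
      using zero_le_power2[of "?s - e / 4"] by (simp add: power2_diff power_divide mult.commute)
    with * have **: "(norm h)\<^sup>2 \<le> e / 2 * norm h + e\<^sup>2 / 16" by linarith
    have "norm h \<le> e"
    proof (rule ccontr)
      assume "\<not> norm h \<le> e"
      then have "e * norm h \<le> norm h * norm h" "e * e \<le> e * norm h" "0 < e * e"
        using e by (auto intro: mult_right_mono mult_left_mono)
      then show False using ** by (simp add: power2_eq_square)
    qed
    then show ?thesis by (simp add: h_def)
  qed
  ultimately show ?thesis using cstar_scaleR[OF A g(1), of 2] by blast
qed

section \<open>Compactness of \<open>x\<close> and of \<open>T\<close>\<close>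

text \<open>
  The conclusion says that \<open>x\<close> is a compact operator.  Fix \<open>v\<close> with \<open>w = x v \<noteq> 0\<close>.  By transitivity
  \<open>\<parallel>w\<parallel> \<parallel>x h\<parallel>\<close> is at most twice the supremum of \<open>\<langle>a w, x h\<rangle> = \<langle>x\<^sup>* a x v, h\<rangle>\<close> over the unit ball
  of \<open>A\<close>, and the operators \<open>x\<^sup>* a x\<close> are all close to one of finitely many operators \<open>m\<close>.  Hence two
  vectors of the unit ball with nearly equal coordinates \<open>\<langle>m v, u\<rangle>\<close> have close images under \<open>x\<close>.
\<close>

lemma finite_net_if_conj_map_compact:
  fixes A :: "('h::complex_hilbert \<Rightarrow>\<^sub>L 'h) set"
  assumes A: "cstar_subalgebra A" and irr: "irreducible_on A" and nz: "\<exists>a\<in>A. a \<noteq> 0"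
    and x: "x \<in> bounded_operators" and cpt: "compact_map_on A (conj_map x)" and e: "0 < e"
  shows "\<exists>N. finite N \<and> N \<subseteq> cball 0 1 \<and>
    (\<forall>u\<in>cball 0 1. \<exists>n\<in>N. norm (blinfun_apply x (u - n)) \<le> e)"
proof (cases "\<forall>v. blinfun_apply x v = 0")
  case True
  then show ?thesis using e by (intro exI[of _ "{0}"]) auto
next
  case False
  then obtain v where v: "blinfun_apply x v \<noteq> 0" by blast
  define w where "w = blinfun_apply x v"
  have w: "0 < norm w" using v by (simp add: w_def)
  have v0: "0 < norm v" using v by (auto simp: blinfun.zero_right)
  define d where "d = e * norm w / 8"
  have d: "0 < d" using e w by (simp add: d_def)
  define d' where "d' = d / norm v"
  have d': "0 < d'" using d v0 by (simp add: d'_def)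
  have "compact (closure (conj_map x ` {a \<in> A. norm a \<le> 1}))"
    using cpt by (simp add: compact_map_on_def)
  then obtain M where M: "finite M" "closure (conj_map x ` {a \<in> A. norm a \<le> 1}) \<subseteq> (\<Union>m\<in>M. ball m d')"
    unfolding compact_eq_totally_bounded using d' by blast
  have "\<exists>N. finite N \<and> N \<subseteq> cball 0 1 \<and>
    (\<forall>u\<in>cball 0 1. \<exists>n\<in>N. \<forall>m\<in>M. \<bar>inner (blinfun_apply m v) u - inner (blinfun_apply m v) n\<bar> < d)"
  proof (rule finite_net_of_coordinates[OF M(1) _ d, where B = "\<Sum>m\<in>M. norm (blinfun_apply m v)"])
    fix u :: 'h and m assume u: "u \<in> cball 0 1" and m: "m \<in> M"
    have "\<bar>inner (blinfun_apply m v) u\<bar> \<le> norm (blinfun_apply m v) * norm u" by (rule Cauchy_Schwarz_ineq2)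
    also have "\<dots> \<le> norm (blinfun_apply m v) * 1" using u by (intro mult_left_mono) auto
    also have "\<dots> \<le> (\<Sum>m\<in>M. norm (blinfun_apply m v))"
      using M(1) member_le_sum[OF m, of "\<lambda>m. norm (blinfun_apply m v)"] by simp
    finally show "\<bar>inner (blinfun_apply m v) u\<bar> \<le> (\<Sum>m\<in>M. norm (blinfun_apply m v))" .
  qed
  then obtain N where N: "finite N" "N \<subseteq> cball 0 1"
    "\<And>u. u \<in> cball 0 1 \<Longrightarrow> \<exists>n\<in>N. \<forall>m\<in>M. \<bar>inner (blinfun_apply m v) u - inner (blinfun_apply m v) n\<bar> < d"
    by blast
  have "\<exists>n\<in>N. norm (blinfun_apply x (u - n)) \<le> e" if u: "u \<in> cball 0 1" for u
  proof -
    obtain n where n: "n \<in> N" "\<And>m. m \<in> M \<Longrightarrow> \<bar>inner (blinfun_apply m v) u - inner (blinfun_apply m v) n\<bar> < d"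
      using N(3)[OF u] by blast
    let ?y = "blinfun_apply x (u - n)"
    have un: "norm (u - n) \<le> 2" using u n(1) N(2) norm_triangle_ineq4[of u n] by fastforce
    have "norm ?y \<le> e"
    proof (cases "?y = 0")
      case True then show ?thesis using e by simp
    next
      case False
      \<comment> \<open>\<open>x (u - n)\<close>, rescaled to the norm of \<open>w\<close>\<close>
      define \<eta> where "\<eta> = (norm w / norm ?y) *\<^sub>R ?y"
      have eta: "norm w = norm \<eta>" using False by (simp add: \<eta>_def)
      obtain a where a: "a \<in> A" "norm a \<le> 1" "norm (blinfun_apply a w - \<eta>) \<le> norm w / 2"
        using irreducible_approximate_transitivity[OF A irr nz _ eta, of "norm w / 2"] w by auto
      obtain m where m: "m \<in> M" "dist m (conj_map x a) < d'"
        using a M(2) closure_subset[of "conj_map x ` {a \<in> A. norm a \<le> 1}"] by fastforce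
      have "norm w * norm ?y = inner \<eta> ?y"
        using False by (simp add: \<eta>_def dot_square_norm power2_eq_square)
      also have "\<dots> = inner (blinfun_apply a w) ?y - inner (blinfun_apply a w - \<eta>) ?y"
        by (simp add: inner_diff_left)
      also have "\<dots> \<le> inner (blinfun_apply a w) ?y + norm w / 2 * norm ?y"
        using Cauchy_Schwarz_ineq2[of "blinfun_apply a w - \<eta>" ?y] mult_right_mono[OF a(3), of "norm ?y"] by simp
      finally have 1: "norm w * norm ?y \<le> 2 * inner (blinfun_apply a w) ?y" by simp
      have "inner (blinfun_apply a w) ?y = inner (blinfun_apply (conj_map x a) v) (u - n)"
        using inner_adjoint_op[OF x, of "u - n" "blinfun_apply a w"]
        by (simp add: conj_map_def w_def inner_commute)
      also have "\<dots> = inner (blinfun_apply m v) (u - n) - inner (blinfun_apply (m - conj_map x a) v) (u - n)"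
        by (simp add: blinfun.diff_left inner_diff_left)
      also have "\<dots> \<le> d + 2 * d"
      proof -
        have "\<bar>inner (blinfun_apply (m - conj_map x a) v) (u - n)\<bar> \<le> norm (blinfun_apply (m - conj_map x a) v) * norm (u - n)"
          by (rule Cauchy_Schwarz_ineq2)
        also have "\<dots> \<le> (norm (m - conj_map x a) * norm v) * 2"
          by (intro mult_mono norm_blinfun un) auto
        also have "\<dots> \<le> (d' * norm v) * 2"
          using m(2) by (intro mult_right_mono) (auto simp: dist_norm)
        also have "\<dots> = 2 * d" using v0 by (simp add: d'_def)
        finally show ?thesis using n(2)[OF m(1)] by (simp add: inner_diff_right)
      qed
      finally have "norm w * norm ?y \<le> 6 * d" using 1 by simp
      then have "norm w * norm ?y \<le> norm w * e" using mult_pos_pos[OF e w] by (simp add: d_def mult.commute)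
      then show ?thesis using w by simp
    qed
    then show ?thesis using n(1) by blast
  qed
  then show ?thesis using N by blast
qed

theorem proposition2p3p2:
  fixes A :: "('h::complex_hilbert \<Rightarrow>\<^sub>L 'h) set"
    and x :: "'h \<Rightarrow>\<^sub>L 'h"
    and T :: "('h \<Rightarrow>\<^sub>L 'h) \<Rightarrow> ('h \<Rightarrow>\<^sub>L 'h)"
  assumes "cstar_subalgebra A"
    and "irreducible_on A"
    and "x \<in> bounded_operators"
    and "compact_map_on A (conj_map x)"
    and "bounded_map_on A T"
    and "map_le_on A (\<lambda>a. 0) T"
    and "map_le_on A T (conj_map x)"
  shows "compact_map_on A T"
proof -
  note A = assms(1)
  let ?S = "T ` {a \<in> A. norm a \<le> 1}"
  have "compact (closure ?S)"
  proof (rule compact_closure_if_finite_nets)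
    fix e :: real assume e: "0 < e"
    show "\<exists>N. finite N \<and> (\<forall>s\<in>?S. \<exists>n\<in>N. dist s n < e)"
    proof (cases "\<exists>a\<in>A. a \<noteq> 0")
      case False
      then have "?S \<subseteq> {T 0}" by auto
      then show ?thesis using e by (intro exI[of _ "{T 0}"]) auto
    next
      case nz: True
      define X where "X = norm x"
      have xu: "norm (blinfun_apply x u) \<le> X" if "norm u \<le> 1" for u
        using norm_blinfun[of x u] mult_left_mono[OF that norm_ge_zero[of x]] by (simp add: X_def)
      have X: "0 \<le> X" by (simp add: X_def)
      have bound: "\<bar>inner (blinfun_apply (T a) u) v\<bar> \<le> 9 * (norm (blinfun_apply x u) * norm (blinfun_apply x v))"
        if "a \<in> A" "norm a \<le> 1" for a u v
        using dominated_form_bound[OF A assms(3,5,6,7) that] .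
      \<comment> \<open>the errors below are at most \<open>2 \<cdot> 18 X \<delta> \<le> e / 2\<close> plus \<open>e / 4\<close>\<close>
      define \<delta> where "\<delta> = e / (72 * X + 1)"
      have D: "0 < 72 * X + 1" using X by simp
      then have \<delta>: "0 < \<delta>" using e by (simp add: \<delta>_def)
      obtain N where N: "finite N" "N \<subseteq> cball 0 1"
        "\<And>u. u \<in> cball 0 1 \<Longrightarrow> \<exists>n\<in>N. norm (blinfun_apply x (u - n)) \<le> \<delta>"
        using finite_net_if_conj_map_compact[OF A assms(2) nz assms(3,4) \<delta>] by blast
      have "\<exists>Q. finite Q \<and> Q \<subseteq> {a \<in> A. norm a \<le> 1} \<and> (\<forall>a\<in>{a \<in> A. norm a \<le> 1}. \<exists>q\<in>Q. \<forall>p\<in>N \<times> N.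
          \<bar>inner (blinfun_apply (T a) (fst p)) (snd p) - inner (blinfun_apply (T q) (fst p)) (snd p)\<bar> < e / 4)"
      proof (rule finite_net_of_coordinates[where B = "9 * (X * X)"])
        fix a p assume a: "a \<in> {a \<in> A. norm a \<le> 1}" and p: "p \<in> N \<times> N"
        have "norm (fst p) \<le> 1" "norm (snd p) \<le> 1" using p N(2) by auto
        then have "norm (blinfun_apply x (fst p)) * norm (blinfun_apply x (snd p)) \<le> X * X"
          using X by (intro mult_mono xu) auto
        then show "\<bar>inner (blinfun_apply (T a) (fst p)) (snd p)\<bar> \<le> 9 * (X * X)"
          using bound[of a "fst p" "snd p"] a by simp
      qed (use N(1) e in auto)
      then obtain Q where Q: "finite Q" "Q \<subseteq> {a \<in> A. norm a \<le> 1}"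
        "\<And>a. a \<in> A \<Longrightarrow> norm a \<le> 1 \<Longrightarrow> \<exists>q\<in>Q. \<forall>p\<in>N \<times> N.
          \<bar>inner (blinfun_apply (T a) (fst p)) (snd p) - inner (blinfun_apply (T q) (fst p)) (snd p)\<bar> < e / 4"
        by blast
      have "\<exists>q\<in>Q. dist (T a) (T q) < e" if a: "a \<in> A" "norm a \<le> 1" for a
      proof -
        obtain q where q: "q \<in> Q"
          and close: "\<And>u v. u \<in> N \<Longrightarrow> v \<in> N \<Longrightarrow>
            \<bar>inner (blinfun_apply (T a) u) v - inner (blinfun_apply (T q) u) v\<bar> < e / 4"
          using Q(3)[OF a] by fastforce
        have qA: "q \<in> A" "norm q \<le> 1" using q Q(2) by auto
        let ?D = "T a - T q"
        have D_bound: "\<bar>inner (blinfun_apply ?D u) v\<bar> \<le> 18 * (norm (blinfun_apply x u) * norm (blinfun_apply x v))" for u v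
          using bound[OF a, of u v] bound[OF qA, of u v] by (simp add: blinfun.diff_left inner_diff_left)
        have "norm ?D \<le> 3 * e / 4"
        proof (rule norm_le_if_inner_le)
          fix u v :: 'h assume uv: "norm u \<le> 1" "norm v \<le> 1"
          obtain m n where mn: "m \<in> N" "n \<in> N" "norm (blinfun_apply x (u - m)) \<le> \<delta>" "norm (blinfun_apply x (v - n)) \<le> \<delta>"
            using N(3)[of u] N(3)[of v] uv by (auto simp: dist_norm)
          have m1: "norm m \<le> 1" using mn(1) N(2) by auto
          have "inner (blinfun_apply ?D u) v = inner (blinfun_apply ?D (u - m)) v + inner (blinfun_apply ?D m) (v - n) + inner (blinfun_apply ?D m) n"
            by (simp add: blinfun.diff_right inner_diff_left inner_diff_right)
          moreover have "\<bar>inner (blinfun_apply ?D (u - m)) v\<bar> \<le> 18 * (\<delta> * X)"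
            using mn uv X \<delta> by (intro order_trans[OF D_bound] mult_left_mono mult_mono xu) auto
          moreover have "\<bar>inner (blinfun_apply ?D m) (v - n)\<bar> \<le> 18 * (X * \<delta>)"
            using mn m1 X \<delta> by (intro order_trans[OF D_bound] mult_left_mono mult_mono xu) auto
          moreover have "\<bar>inner (blinfun_apply ?D m) n\<bar> \<le> e / 4"
            using close[OF mn(1,2)] by (simp add: blinfun.diff_left inner_diff_left)
          moreover have "72 * (X * \<delta>) \<le> e"
            using D e X by (simp add: \<delta>_def field_simps)
          ultimately show "inner (blinfun_apply ?D u) v \<le> 3 * e / 4"
            by (simp add: mult.commute)
        qed (use e in simp)
        then show ?thesis using q e by (auto simp: dist_norm intro!: bexI[of _ q])
      qed
      then show ?thesis using Q(1) by (intro exI[of _ "T ` Q"]) auto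
    qed
  qed
  then show ?thesis using assms(5) by (simp add: compact_map_on_def)
qed

end
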